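(* Let $0<|q|<1$ and $a,b,c,d\in\mathbb{C}$ with $\max\{|a|,|b|,|c|,|d|\}<1$ (and such that no denominator below vanishes). For $x=\cos\theta$, $\theta\in[0,\pi]$, let $h(x,y)=(ye^{i\theta},ye^{-i\theta};q)_\infty$ and \[ w(x)=\frac{h(x,1)\,h(x,-1)\,h(x,q^{1/2})\,h(x,-q^{1/2})}{h(x,a)\,h(x,b)\,h(x,c)\,h(x,d)} . \] Then for all nonnegative integers $n,m$, \[ \frac{1}{2\pi}\int_{-1}^{1}\frac{w(x)}{\sqrt{1-x^2}}\,(ae^{i\theta},ae^{-i\theta};q)_n\,(ae^{i\theta},ae^{-i\theta};q)_m\,dx =\mathcal{K}\,\frac{(ab,ac,ad;q)_m\,(ab,ac,ad;q)_n}{(abcd;q)_m\,(abcd;q)_n}\;{}_8W_7\!\left(abcd/q;\,bc,\,bd,\,cd,\,q^{-m},\,q^{-n};\,q,\,a^2q^{m+n}\right), \] where $\mathcal{K}=\dfrac{(abcd;q)_\infty}{(q,ab,ac,ad,bc,bd,cd;q)_\infty}$.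
   Context: $(x;q)_k=\prod_{j=0}^{k-1}(1-xq^j)$, $(x;q)_\infty=\prod_{j\ge0}(1-xq^j)$, $(x_1,\dots,x_r;q)_k=\prod_i(x_i;q)_k$ (also for $k=\infty$). The very-well-poised series is \[ {}_{8}W_7(a_1;a_4,\dots,a_{8};q,z)=\sum_{k\ge0}\frac{1-a_1q^{2k}}{1-a_1}\,\frac{(a_1,a_4,\dots,a_{8};q)_k}{(q,a_1q/a_4,\dots,a_1q/a_{8};q)_k}\,z^k \] (terminating here). The paper presents this as the dual form of the orthogonality relation of the Askey–Wilson polynomials. *)

theory Defs
  imports "HOL-Analysis.Analysis"
begin

definition qpoch :: "complex \<Rightarrow> complex \<Rightarrow> nat \<Rightarrow> complex" where
  "qpoch x q k = (\<Prod>j<k. 1 - x * q ^ j)"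

definition qpoch_inf :: "complex \<Rightarrow> complex \<Rightarrow> complex" where
  "qpoch_inf x q = (\<Prod>j. 1 - x * q ^ j)"

definition qpochs :: "complex list \<Rightarrow> complex \<Rightarrow> nat \<Rightarrow> complex" where
  "qpochs xs q k = (\<Prod>x\<leftarrow>xs. qpoch x q k)"

definition qpochs_inf :: "complex list \<Rightarrow> complex \<Rightarrow> complex" where
  "qpochs_inf xs q = (\<Prod>x\<leftarrow>xs. qpoch_inf x q)"

definition W87 ::
  "complex \<Rightarrow> complex \<Rightarrow> complex \<Rightarrow> complex \<Rightarrow> complex \<Rightarrow> complex \<Rightarrow> complex \<Rightarrow> complex \<Rightarrow> complex"
where
  "W87 a1 a4 a5 a6 a7 a8 q z =
     (\<Sum>k. (1 - a1 * q ^ (2 * k)) / (1 - a1)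
        * (qpochs [a1, a4, a5, a6, a7, a8] q k
           / qpochs [q, a1 * q / a4, a1 * q / a5, a1 * q / a6, a1 * q / a7, a1 * q / a8] q k)
        * z ^ k)"

text \<open>
  For \<open>x = cos \<theta>\<close> with \<open>\<theta> \<in> [0, \<pi>]\<close> one has \<open>\<theta> = arccos x\<close>,
  so \<open>cis (arccos x)\<close> is the number written \<open>e\<^sup>i\<^sup>\<theta>\<close> and \<open>cis (- arccos x)\<close> its inverse.
\<close>

definition aw_h :: "complex \<Rightarrow> real \<Rightarrow> complex \<Rightarrow> complex" where
  "aw_h q x y = qpochs_inf [y * cis (arccos x), y * cis (- arccos x)] q"

text \<open>
  \<open>csqrt q\<close> is the principal square root; as both roots \<open>\<plusminus> q\<^sup>1\<^sup>/\<^sup>2\<close> occur symmetrically,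
  the weight does not depend on the branch.
\<close>

definition aw_weight ::
  "complex \<Rightarrow> complex \<Rightarrow> complex \<Rightarrow> complex \<Rightarrow> complex \<Rightarrow> real \<Rightarrow> complex" where
  "aw_weight q a b c d x =
     (aw_h q x 1 * aw_h q x (- 1) * aw_h q x (csqrt q) * aw_h q x (- csqrt q))
     / (aw_h q x a * aw_h q x b * aw_h q x c * aw_h q x d)"

definition aw_const :: "complex \<Rightarrow> complex \<Rightarrow> complex \<Rightarrow> complex \<Rightarrow> complex \<Rightarrow> complex" where
  "aw_const q a b c d =
     qpoch_inf (a * b * c * d) q / qpochs_inf [q, a * b, a * c, a * d, b * c, b * d, c * d] q"

definition aw_integrand ::
  "complex \<Rightarrow> complex \<Rightarrow> complex \<Rightarrow> complex \<Rightarrow> complex \<Rightarrow> nat \<Rightarrow> nat \<Rightarrow> real \<Rightarrow> complex" where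
  "aw_integrand q a b c d n m x =
     aw_weight q a b c d x / of_real (sqrt (1 - x\<^sup>2))
     * qpochs [a * cis (arccos x), a * cis (- arccos x)] q n
     * qpochs [a * cis (arccos x), a * cis (- arccos x)] q m"

end

theory Submission
  imports Defs "HOL-Complex_Analysis.Complex_Analysis"
begin

text \<open>
  Write \<open>\<phi>\<^sub>n = (a z, a/z; q)\<^sub>n\<close> with \<open>z = e\<^sup>i\<^sup>\<theta>\<close>, \<open>s = a b c d\<close>, and let \<open>M(n,m)\<close> be the integral of the weight times
  \<open>\<phi>\<^sub>n \<phi>\<^sub>m\<close>. Since \<open>\<phi>\<^sub>m\<^sub>+\<^sub>1 = \<phi>\<^sub>m (1 - 2 a q\<^sup>m x + a\<^sup>2 q\<^sup>2\<^sup>m)\<close>, eliminating \<open>x\<close> gives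
  \<open>q\<^sup>n M(n,m+1) - q\<^sup>m M(n+1,m) = (q\<^sup>n - q\<^sup>m) (1 - a\<^sup>2 q\<^sup>m\<^sup>+\<^sup>n) M(n,m)\<close>, which determines \<open>M\<close> from its
  values at \<open>m = 0\<close>. Up to the prefactor, the terms of the \<open>8W7\<close> series factor as
  \<open>A\<^sub>k B\<^sub>k(n) B\<^sub>k(m)\<close>, where \<open>B\<^sub>k(n+1)\<close> is given by a three-term recurrence in \<open>k\<close> that is symmetric with
  respect to the weights \<open>A\<^sub>k\<close>; the discrete Wronskian therefore telescopes and the series satisfies the
  same recurrence as \<open>M\<close>.

  The value \<open>M(n,0)\<close> is the Askey-Wilson integral with \<open>a\<close> replaced by \<open>a q\<^sup>n\<close>. For that integral, the function
  \<open>g(z) = z (z\<^sup>2, q/z\<^sup>2)\<^sub>\<infinity> / \<Prod> (a\<^sub>j z, a\<^sub>j q/z)\<^sub>\<infinity>\<close> satisfies \<open>g(q z) = - g(1/z)\<close>, so shifting the contour from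
  \<open>|z| = 1\<close> to \<open>|z| = |q|\<close> shows that its integral vanishes. Symmetrizing in \<open>z\<close> and \<open>1/z\<close>, this evaluates the
  first moment of the weight and yields the ratio of the integrals with parameters \<open>a q\<close> and \<open>a\<close>. Iterating
  in all four parameters reduces to \<open>a = b = c = d = 0\<close>, and the remaining constant is read off from the
  parameters \<open>q, -q, q\<^sup>1\<^sup>/\<^sup>2, -q\<^sup>1\<^sup>/\<^sup>2\<close>, for which the weight is \<open>(1 - z\<^sup>2) (1 - z\<^sup>-\<^sup>2)\<close>.
\<close>

section \<open>Finite q-shifted factorials and the polynomial identities behind the
  recurrence\<close>

lemma qpoch_0 [simp]: "qpoch x q 0 = 1"
  by (simp add: qpoch_def)

lemma qpoch_Suc: "qpoch x q (Suc n) = qpoch x q n * (1 - x * q ^ n)"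
  by (simp add: qpoch_def)

lemma qpoch_add: "qpoch x q (m + n) = qpoch x q m * qpoch (x * q ^ m) q n"
  by (induction n) (simp_all add: qpoch_Suc power_add)

lemma qpochs_Nil [simp]: "qpochs [] q n = 1"
  and qpochs_Cons [simp]: "qpochs (x # xs) q n = qpoch x q n * qpochs xs q n"
  by (simp_all add: qpochs_def)

lemma norm_mult_power_less_1:
  fixes x q :: complex
  assumes "norm x < 1" "norm q \<le> 1"
  shows "norm (x * q ^ n) < 1"
proof -
  have "norm (x * q ^ n) \<le> norm x * 1"
    unfolding norm_mult norm_power using assms by (intro mult_left_mono power_le_one) auto
  with assms show ?thesis by simp
qed

lemma one_minus_mult_power_nonzero:
  fixes x q :: complex
  assumes "norm x < 1" "norm q \<le> 1"
  shows "1 - x * q ^ n \<noteq> 0"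
  using norm_mult_power_less_1[OF assms, of n] by auto

lemma qpoch_nonzero:
  assumes "norm x < 1" "norm q \<le> 1"
  shows "qpoch x q n \<noteq> 0"
  using one_minus_mult_power_nonzero[OF assms] by (simp add: qpoch_def)

lemma norm_mult_less_1:
  fixes x y :: complex
  assumes "norm x < 1" "norm y < 1"
  shows "norm (x * y) < 1"
  unfolding norm_mult using assms mult_strict_mono'[of "norm x" 1 "norm y" 1] by simp

text \<open>The coefficients \<open>u\<close>, \<open>v\<close>, \<open>w\<close> are fractions with
  common denominator \<open>D\<close> and numerators \<open>u'\<close>, \<open>v'\<close>,
  \<open>w'\<close>. Clearing \<open>D\<close> leaves a polynomial identity, and \<open>X\<close> is
  the factor shared by all the values in the recurrence.\<close>

lemma cancel_common_denominator:
  fixes D X :: complex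
  assumes "L * D = c * y * D - N * (u' * x + v' * y + w' * z)"
    and "u * D = u'" "v * D = v'" "w * D = w'" "D \<noteq> 0"
  shows "X * L = c * (X * y) - N * (u * (X * x) + v * (X * y) + w * (X * z))"
proof -
  have "L * D = (c * y - N * (u * x + v * y + w * z)) * D"
    unfolding assms(1) assms(2-4)[symmetric] by (simp add: algebra_simps)
  then have "L = c * y - N * (u * x + v * y + w * z)"
    using assms(5) by simp
  then show ?thesis by algebra
qed

text \<open>The case \<open>k = Suc j\<close> of the three-term recurrence with all denominators
  cleared, where \<open>P\<close> stands for \<open>q ^ j\<close> and \<open>N\<close> for
  \<open>q ^ n\<close>.\<close>

lemma three_term_polynomial:
  fixes a b c d q P N :: complex
  defines "s \<equiv> a*b*c*d"
  defines "D0 \<equiv> 1 - s*P^2" and "D1 \<equiv> 1 - s*P^2*q" and "D2 \<equiv> 1 - s*P^2*q^2"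
  shows "(N*q-1)*P*((1-a*b*N)*(1-a*c*N)*(1-a*d*N))*(D0*D1*D2) =
    (1+a^2*N^2)*((N-P)*(1-s*N*P*q))*(D0*D1*D2) - N*(
     a^2*(1-c*d*(q*P))*(1-b*d*(q*P))*(1-b*c*(q*P))*(1-s*P)*D0*((N-P)*(N-q*P))
     + ((1+a^2)*(D0*D1*D2) - (1-a*b*(q*P))*(1-a*c*(q*P))*(1-a*d*(q*P))*(1-s*P)*D0
         - a^2*(1-q*P)*(1-b*c*P)*(1-b*d*P)*(1-c*d*P)*D2)*((N-P)*(1-s*N*P*q))
     + (1-q*P)*(1-a*b*P)*(1-a*c*P)*(1-a*d*P)*D2*((1-s*N*P)*(1-s*N*P*q)))"
  unfolding s_def D0_def D1_def D2_def
  by algebra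

text \<open>The summand \<open>0 * 0\<close> is the missing \<open>k - 1\<close> term in the shape required by \<open>cancel_common_denominator\<close>.\<close>

lemma three_term_polynomial_0:
  fixes a b c d N :: complex
  defines "s \<equiv> a*b*c*d"
  shows "(1-a*b*N)*(1-a*c*N)*(1-a*d*N)*(1-s) =
    (1+a^2*N^2)*(1-s*N)*(1-s) - N*(
     a^2*(1-c*d)*(1-b*d)*(1-b*c)*(N-1)
     + ((1+a^2)*(1-s) - (1-a*b)*(1-a*c)*(1-a*d))*(1-s*N) + 0 * 0)"
  unfolding s_def
  by algebra

subsection \<open>The recurrence satisfied by the series\<close>

locale askey_wilson =
  fixes q a b c d :: complex
  assumes q: "q \<noteq> 0" "norm q < 1"
    and norm_less_1: "norm a < 1" "norm b < 1" "norm c < 1" "norm d < 1"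
begin

abbreviation s :: complex where "s \<equiv> a * b * c * d"

lemma norm_products:
  "norm (a * b) < 1" "norm (a * c) < 1" "norm (a * d) < 1"
  "norm (b * c) < 1" "norm (b * d) < 1" "norm (c * d) < 1" "norm s < 1"
  using norm_less_1 by (auto intro!: norm_mult_less_1)

text \<open>The factor \<open>1 - s / q\<close> is not of this form, since
  \<open>norm s < norm q\<close> is not assumed; the later lemmas carry it as a hypothesis.\<close>

lemma factor_nonzero:
  "1 - a * b * q ^ n \<noteq> 0" "1 - a * c * q ^ n \<noteq> 0" "1 - a * d * q ^ n \<noteq> 0"
  "1 - b * c * q ^ n \<noteq> 0" "1 - b * d * q ^ n \<noteq> 0" "1 - c * d * q ^ n \<noteq> 0"
  "1 - s * q ^ n \<noteq> 0"
  using one_minus_mult_power_nonzero[OF norm_products(1)] one_minus_mult_power_nonzero[OF norm_products(2)]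
    one_minus_mult_power_nonzero[OF norm_products(3)] one_minus_mult_power_nonzero[OF norm_products(4)]
    one_minus_mult_power_nonzero[OF norm_products(5)] one_minus_mult_power_nonzero[OF norm_products(6)]
    one_minus_mult_power_nonzero[OF norm_products(7)] q
  by auto

text \<open>
  The factor \<open>B\<^sub>k(n)\<close> of the series: \<open>(q\<^sup>-\<^sup>n; q)\<^sub>k q\<^sup>n\<^sup>k\<close> is written as \<open>\<Prod>j<k. q\<^sup>n - q\<^sup>j\<close>, and \<open>(s; q)\<^sub>n (s q\<^sup>n; q)\<^sub>k\<close> as \<open>(s; q)\<^sub>n\<^sub>+\<^sub>k\<close>.
\<close>

definition dual_poly :: "nat \<Rightarrow> nat \<Rightarrow> complex" where
  "dual_poly k n = qpochs [a * b, a * c, a * d] q n * (\<Prod>j<k. q ^ n - q ^ j) / qpoch s q (n + k)"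

text \<open>The part of the series term that depends on neither \<open>n\<close> nor
  \<open>m\<close>. Of the argument only \<open>a ^ (2 * k)\<close> remains, because
  \<open>dual_poly\<close> absorbs the powers of \<open>q ^ n\<close> and
  \<open>q ^ m\<close>.\<close>

definition dual_weight :: "nat \<Rightarrow> complex" where
  "dual_weight k = (1 - s / q * q ^ (2 * k)) / (1 - s / q)
     * (qpochs [s / q, b * c, b * d, c * d] q k / qpochs [q, a * d, a * c, a * b] q k) * a ^ (2 * k)"

text \<open>
  Dividing the three-term recurrence by \<open>dual_poly k n\<close> turns it into a rational identity in \<open>N = q\<^sup>n\<close>; the
  coefficients \<open>jac_up\<close> and \<open>jac_down\<close> are read off at its two poles \<open>N = 1 / (s q\<^sup>k)\<close> and
  \<open>N = q\<^sup>k / q\<close>.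
\<close>

definition jac_up :: "nat \<Rightarrow> complex" where
  "jac_up k = a\<^sup>2 * (1 - c * d * q ^ k) * (1 - b * d * q ^ k) * (1 - b * c * q ^ k) * (1 - s / q * q ^ k)
     / ((1 - s * q ^ (2 * k)) * (1 - s / q * q ^ (2 * k)))"

definition jac_diag :: "nat \<Rightarrow> complex" where
  "jac_diag k = 1 + a\<^sup>2
     - (1 - a * b * q ^ k) * (1 - a * c * q ^ k) * (1 - a * d * q ^ k) * (1 - s / q * q ^ k)
       / ((1 - s * q ^ (2 * k)) * (1 - s / q * q ^ (2 * k)))
     - a\<^sup>2 * (1 - q ^ k) * (1 - b * c * q ^ k / q) * (1 - b * d * q ^ k / q) * (1 - c * d * q ^ k / q)
       / ((1 - s / q * q ^ (2 * k)) * (1 - s / q\<^sup>2 * q ^ (2 * k)))"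

definition jac_down :: "nat \<Rightarrow> complex" where
  "jac_down k = (1 - q ^ k) * (1 - a * b * q ^ k / q) * (1 - a * c * q ^ k / q) * (1 - a * d * q ^ k / q)
     / ((1 - s / q * q ^ (2 * k)) * (1 - s / q\<^sup>2 * q ^ (2 * k)))"

lemma dual_poly_eq_0: "n < k \<Longrightarrow> dual_poly k n = 0"
  unfolding dual_poly_def by (auto intro!: prod_zero)

text \<open>After division by a common factor \<open>X\<close>, only a rational identity in
  \<open>q ^ n\<close> and \<open>q ^ k\<close> is left. At \<open>k = 0\<close> the truncated index
  \<open>k - 1\<close> does no harm, since \<open>jac_down 0 = 0\<close>.\<close>

lemma three_term:
  assumes "1 - s / q \<noteq> 0"
  shows "dual_poly k (Suc n) = (1 + a\<^sup>2 * (q ^ n)\<^sup>2) * dual_poly k n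
    - q ^ n * (jac_up k * dual_poly (Suc k) n + jac_diag k * dual_poly k n + jac_down k * dual_poly (k - 1) n)"
proof (cases k)
  case 0
  define N X where "N = q ^ n" and "X = qpochs [a * b, a * c, a * d] q n / (qpoch s q n * (1 - s * N))"
  have nz: "1 - s * N \<noteq> 0" "1 - s \<noteq> 0"
    using factor_nonzero(7)[of n] factor_nonzero(7)[of 0] by (simp_all add: N_def)
  have dp: "dual_poly 0 (Suc n) = X * ((1-a*b*N)*(1-a*c*N)*(1-a*d*N))"
    "dual_poly 0 n = X * (1 - s * N)" "dual_poly (Suc 0) n = X * (N - 1)"
    using nz by (simp_all add: dual_poly_def qpoch_Suc X_def N_def)
  have u: "jac_up 0 * (1 - s) = a^2*(1-c*d)*(1-b*d)*(1-b*c)"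
    and v: "jac_diag 0 * (1 - s) = (1+a^2)*(1-s) - (1-a*b)*(1-a*c)*(1-a*d)"
    and w: "jac_down 0 = 0"
  proof -
    define t where "t = 1 - s / q"
    have t: "t \<noteq> 0" using assms by (simp add: t_def)
    show "jac_up 0 * (1 - s) = a^2*(1-c*d)*(1-b*d)*(1-b*c)"
      unfolding jac_up_def mult_0_right power_0 mult_1_right t_def[symmetric]
      using t nz by simp
    have "jac_diag 0 = 1+a^2 - (1-a*b)*(1-a*c)*(1-a*d)/(1-s)"
      unfolding jac_diag_def mult_0_right power_0 mult_1_right t_def[symmetric]
      using t nz by simp
    then show "jac_diag 0 * (1 - s) = (1+a^2)*(1-s) - (1-a*b)*(1-a*c)*(1-a*d)"
      using nz by (simp add: left_diff_distrib[of "1 + a\<^sup>2"])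
    show "jac_down 0 = 0"
      by (simp add: jac_down_def)
  qed
  show ?thesis
    unfolding 0 diff_0_eq_0 dp(1,3) N_def[symmetric] w mult_zero_left
    using cancel_common_denominator[OF three_term_polynomial_0 u v _ nz(2), of 0 X] dp by simp
next
  case (Suc j)
  \<comment> \<open>The denominator of \<open>X\<close> is \<open>qpoch s q (n + j + 2)\<close>, the
    longest one occurring in the four values of \<open>dual_poly\<close>.\<close>
  define P N X where "P = q ^ j" and "N = q ^ n"
    and "X = qpochs [a * b, a * c, a * d] q n * (\<Prod>i<j. N - q ^ i) / (qpoch s q (n + j) * (1 - s * N * P) * (1 - s * N * P * q))"
  define D0 D1 D2 where "D0 = 1 - s*P^2" and "D1 = 1 - s*P^2*q" and "D2 = 1 - s*P^2*q^2"
  have nz: "1 - s * N * P \<noteq> 0" "1 - s * N * P * q \<noteq> 0"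
    using factor_nonzero(7)[of "n + j"] factor_nonzero(7)[of "n + j + 1"]
    by (simp_all add: N_def P_def power_add mult_ac)
  have D: "D0 \<noteq> 0" "D1 \<noteq> 0" "D2 \<noteq> 0"
    using factor_nonzero(7)[of "2 * j"] factor_nonzero(7)[of "2 * j + 1"] factor_nonzero(7)[of "2 * j + 2"]
    by (simp_all add: D0_def D1_def D2_def P_def power_add power_mult power2_eq_square power_mult_distrib mult_ac)
  \<comment> \<open>The factor \<open>i = 0\<close> is split off; each of the other \<open>j\<close>
    factors releases one \<open>q\<close>, which together give \<open>P\<close>.\<close>
  have "(\<Prod>i<Suc j. N * q - q ^ i) = (N * q - 1) * P * (\<Prod>i<j. N - q ^ i)"
  proof -
    have "(\<Prod>i<j. N * q - q ^ Suc i) = (\<Prod>i<j. q * (N - q ^ i))"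
      by (simp add: algebra_simps)
    then show ?thesis
      by (simp add: prod.lessThan_Suc_shift prod.distrib P_def del: prod.lessThan_Suc)
  qed
  then have dp1: "dual_poly (Suc j) (Suc n) = X * ((N*q-1)*P*((1-a*b*N)*(1-a*c*N)*(1-a*d*N)))"
    using nz by (simp add: dual_poly_def qpoch_Suc X_def power_add mult_ac del: prod.lessThan_Suc
        flip: N_def P_def)
  have dp2: "dual_poly (Suc j) n = X * ((N - P) * (1 - s * N * P * q))"
    using nz by (simp add: dual_poly_def qpoch_Suc X_def power_add mult_ac flip: N_def P_def)
  have dp3: "dual_poly (Suc (Suc j)) n = X * ((N - P) * (N - q * P))"
    using nz by (simp add: dual_poly_def qpoch_Suc X_def power_add mult_ac flip: N_def P_def)
  have dp4: "dual_poly j n = X * ((1 - s * N * P) * (1 - s * N * P * q))"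
    using nz by (simp add: dual_poly_def qpoch_Suc X_def power_add mult_ac flip: N_def P_def)
  have pw: "q ^ (Suc j) = q * P" "s / q * (q * P) = s * P" "s / q * q ^ (2 * Suc j) = s*P^2*q"
    "s / q\<^sup>2 * q ^ (2 * Suc j) = s*P^2" "s * q ^ (2 * Suc j) = s*P^2*q^2"
    "x * (q * P) / q = x * P" for x
    using q(1) by (simp_all add: P_def power2_eq_square field_simps flip: power_add mult_2)
  have u: "jac_up (Suc j) * (D0 * D1 * D2) =
      a^2*(1-c*d*(q*P))*(1-b*d*(q*P))*(1-b*c*(q*P))*(1-s*P)*D0"
    using D q(1) unfolding jac_up_def pw D1_def[symmetric] D2_def[symmetric] by simp
  have v: "jac_diag (Suc j) * (D0 * D1 * D2) =
      (1+a^2)*(D0*D1*D2) - (1-a*b*(q*P))*(1-a*c*(q*P))*(1-a*d*(q*P))*(1-s*P)*D0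
         - a^2*(1-q*P)*(1-b*c*P)*(1-b*d*P)*(1-c*d*P)*D2"
  proof -
    have frac: "(e - X / (D2 * D1) - Y / (D1 * D0)) * (D0 * D1 * D2) = e * (D0 * D1 * D2) - X * D0 - Y * D2"
      for e X Y using D by (simp add: left_diff_distrib)
    show ?thesis
      unfolding jac_diag_def pw D0_def[symmetric] D1_def[symmetric] D2_def[symmetric] by (rule frac)
  qed
  have w: "jac_down (Suc j) * (D0 * D1 * D2) = (1-q*P)*(1-a*b*P)*(1-a*c*P)*(1-a*d*P)*D2"
    using D q(1) unfolding jac_down_def pw D0_def[symmetric] D1_def[symmetric] by simp
  show ?thesis
    unfolding Suc diff_Suc_1 dp1 dp2 dp3 dp4 N_def[symmetric]
    using D q(1)
    by (intro cancel_common_denominator[OF three_term_polynomial[of N q P a b c d, folded D0_def D1_def D2_def] u v w]) simp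
qed

text \<open>Detailed balance: the ratio of consecutive weights is
  \<open>jac_up k / jac_down (Suc k)\<close>, so the tridiagonal operator is symmetric with respect
  to \<open>dual_weight\<close>.\<close>

lemma jac_symmetric:
  assumes "1 - s / q \<noteq> 0"
  shows "dual_weight k * jac_up k = dual_weight (Suc k) * jac_down (Suc k)"
proof -
  define Q where "Q = q ^ k"
  have ne: "1 - q * q ^ k \<noteq> 0"
    using one_minus_mult_power_nonzero[of q q k] q by simp
  have pw: "s / q * q ^ (2 * Suc k) = s * Q^2 * q" "s / q\<^sup>2 * q ^ (2 * Suc k) = s * Q^2"
     "s * q ^ (2 * k) = s * Q^2" "q ^ (2 * k) = Q^2" "x * q ^ Suc k / q = x * Q" for x
    using q(1) by (simp_all add: Q_def power2_eq_square field_simps flip: power_add mult_2)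
  have D: "1 - s * Q^2 \<noteq> 0" "1 - s * Q^2 * q \<noteq> 0"
    using factor_nonzero(7)[of "2 * k"] factor_nonzero(7)[of "2 * k + 1"]
    by (simp_all add: Q_def power_mult power2_eq_square power_mult_distrib mult_ac)
  have D': "1 - s / q * Q^2 \<noteq> 0"
  proof (cases k)
    case 0 then show ?thesis using assms by (simp add: Q_def)
  next
    case (Suc j)
    then have "s / q * Q^2 = s * q ^ (2 * j + 1)"
      using q by (simp add: Q_def power2_eq_square mult_2 power_add)
    then show ?thesis using factor_nonzero(7)[of "2 * j + 1"] by simp
  qed
  define Y where "Y = qpochs [s / q, b * c, b * d, c * d] q k / (qpochs [q, a * d, a * c, a * b] q k * (1 - s / q)) * a ^ (2 * k)"
  have 1: "dual_weight k = Y * (1 - s / q * Q^2)"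
    unfolding dual_weight_def Y_def pw divide_inverse by (simp add: mult_ac)
  have 2: "dual_weight (Suc k) = Y * (1 - s * Q^2 * q) * ((1 - s / q * Q) * (1 - b*c*Q) * (1 - b*d*Q) * (1-c*d*Q)
      / ((1 - q * Q) * (1-a*d*Q)*(1-a*c*Q)*(1-a*b*Q))) * a^2"
    unfolding dual_weight_def pw(1) Y_def
    by (simp add: qpoch_Suc power_add mult_ac power2_eq_square flip: Q_def)
  have 3: "jac_up k = a\<^sup>2 * (1 - c * d * Q) * (1 - b * d * Q) * (1 - b * c * Q) * (1 - s / q * Q)
     / ((1 - s * Q^2) * (1 - s / q * Q^2))"
    by (simp add: jac_up_def pw flip: Q_def)
  have 4: "jac_down (Suc k) = (1 - q * Q) * (1 - a * b * Q) * (1 - a * c * Q) * (1 - a * d * Q)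
     / ((1 - s * Q^2 * q) * (1 - s * Q^2))"
    unfolding jac_down_def pw by (simp add: Q_def)
  have nz': "1 - q * Q \<noteq> 0" "1-a*d*Q \<noteq> 0" "1-a*c*Q \<noteq> 0" "1-a*b*Q \<noteq> 0"
    using ne factor_nonzero[of k] by (simp_all add: Q_def)
  have "dual_weight k * jac_up k = Y * (a\<^sup>2 * (1 - c * d * Q) * (1 - b * d * Q) * (1 - b * c * Q) * (1 - s / q * Q)
     / (1 - s * Q^2))"
    unfolding 1 3 using D' q(1) by simp
  also have "\<dots> = dual_weight (Suc k) * jac_down (Suc k)"
    unfolding 2 4 using D nz' by simp
  finally show ?thesis .
qed

text \<open>The cutoff \<open>K\<close> is kept free so that \<open>n\<close> and \<open>m\<close>
  can vary under one bound; terms with \<open>k > n\<close> or \<open>k > m\<close> vanish.\<close>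

definition dual_sum :: "nat \<Rightarrow> nat \<Rightarrow> nat \<Rightarrow> complex" where
  "dual_sum K n m = (\<Sum>k<K. dual_weight k * dual_poly k n * dual_poly k m)"

text \<open>Inserting \<open>three_term\<close> in both sums cancels the diagonal terms, and the
  neighbouring terms combine to \<open>W k - V k\<close>. The telescoped boundary value contains
  \<open>dual_poly K n\<close> and \<open>dual_poly K m\<close>, which vanish for
  \<open>n, m < K\<close>.\<close>

lemma dual_sum_rec:
  assumes "1 - s / q \<noteq> 0" "n < K" "m < K"
  shows "q ^ n * dual_sum K n (Suc m) - q ^ m * dual_sum K (Suc n) m
    = (q ^ n - q ^ m) * (1 - a\<^sup>2 * q ^ (m + n)) * dual_sum K n m"
proof -
  \<comment> \<open>\<open>W\<close> is the weighted discrete Wronskian of the sequences for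
    \<open>n\<close> and \<open>m\<close>; \<open>V\<close> is its shift by one index, with value 0
    at the left end.\<close>
  define W where "W k = dual_weight k * jac_up k *
      (dual_poly k n * dual_poly (Suc k) m - dual_poly (Suc k) n * dual_poly k m)" for k
  define V where "V k = (if k = 0 then 0 else W (k - 1))" for k
  have down: "dual_weight k * jac_down k *
      (dual_poly k n * dual_poly (k - 1) m - dual_poly (k - 1) n * dual_poly k m) = - V k" for k
  proof (cases k)
    case 0
    then show ?thesis by (simp add: V_def jac_down_def)
  next
    case (Suc j)
    show ?thesis
      unfolding Suc V_def W_def jac_symmetric[OF assms(1)] by (simp add: algebra_simps)
  qed
  have term_eq: "q ^ n * (dual_weight k * dual_poly k n * dual_poly k (Suc m))
      - q ^ m * (dual_weight k * dual_poly k (Suc n) * dual_poly k m)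
      = (q ^ n - q ^ m) * (1 - a\<^sup>2 * q ^ (m + n)) * (dual_weight k * dual_poly k n * dual_poly k m)
        - q ^ (m + n) * (W k - V k)" for k
  proof -
    have alg: "N * (A * p * ((1 + a\<^sup>2 * M\<^sup>2) * p' - M * (u * x' + v * p' + w * y')))
        - M * (A * ((1 + a\<^sup>2 * N\<^sup>2) * p - N * (u * x + v * p + w * y)) * p')
        = (N - M) * (1 - a\<^sup>2 * (M * N)) * (A * p * p') - M * N * (A * u * (p * x' - x * p') - V')"
      if "A * w * (p * y' - y * p') = - V'" for N M A p p' u x x' v w y y' V' :: complex
      using that by algebra
    show ?thesis
      unfolding three_term[OF assms(1), of k n] three_term[OF assms(1), of k m] W_def power_add
      by (rule alg[OF down])
  qed
  have tel: "(\<Sum>k<K. W k - V k) = 0"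
  proof -
    obtain K' where K: "K = Suc K'"
      using assms by (cases K) auto
    have "(\<Sum>k<K. W k - V k) = (\<Sum>k<K. V (Suc k) - V k)"
      by (simp add: V_def)
    also have "\<dots> = V K - V 0"
      by (rule sum_lessThan_telescope)
    also have "\<dots> = 0"
      using assms dual_poly_eq_0[of n K] dual_poly_eq_0[of m K] by (simp add: V_def W_def K)
    finally show ?thesis .
  qed
  have "q ^ n * dual_sum K n (Suc m) - q ^ m * dual_sum K (Suc n) m
     = (\<Sum>k<K. q ^ n * (dual_weight k * dual_poly k n * dual_poly k (Suc m))
      - q ^ m * (dual_weight k * dual_poly k (Suc n) * dual_poly k m))"
    by (simp add: dual_sum_def sum_distrib_left sum_subtractf)
  also have "\<dots> = (q ^ n - q ^ m) * (1 - a\<^sup>2 * q ^ (m + n)) * dual_sum K n m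
       - q ^ (m + n) * (\<Sum>k<K. W k - V k)"
    unfolding term_eq sum_subtractf[of _ "\<lambda>k. q ^ (m + n) * (W k - V k)"] dual_sum_def sum_distrib_left ..
  finally show ?thesis by (simp add: tel)
qed

text \<open>Only \<open>k = 0\<close> contributes, because \<open>dual_poly k 0 = 0\<close> for
  \<open>k > 0\<close>.\<close>

lemma dual_sum_0:
  assumes "1 - s / q \<noteq> 0" "0 < K"
  shows "dual_sum K n 0 = qpochs [a * b, a * c, a * d] q n / qpoch s q n"
proof -
  obtain K' where K: "K = Suc K'"
    using assms by (cases K) auto
  have "dual_sum K n 0 = dual_weight 0 * dual_poly 0 n * dual_poly 0 0"
    unfolding dual_sum_def K sum.lessThan_Suc_shift by (simp add: dual_poly_eq_0)
  also have "\<dots> = dual_poly 0 n"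
    using assms(1) q(1) by (simp add: dual_weight_def dual_poly_def)
  finally show ?thesis by (simp add: dual_poly_def)
qed

text \<open>Since \<open>q ^ n\<close> is nonzero, the recurrence yields \<open>M n (Suc m)\<close>
  from \<open>M n m\<close> and \<open>M (Suc n) m\<close>. Both stay within the bound, as
  \<open>Suc n + m = n + Suc m\<close>.\<close>

lemma dual_sum_unique:
  fixes M :: "nat \<Rightarrow> nat \<Rightarrow> complex"
  assumes "1 - s / q \<noteq> 0"
    and rec: "\<And>n m. q ^ n * M n (Suc m) - q ^ m * M (Suc n) m
        = (q ^ n - q ^ m) * (1 - a\<^sup>2 * q ^ (m + n)) * M n m"
    and init: "\<And>n. M n 0 = C * (qpochs [a * b, a * c, a * d] q n / qpoch s q n)"
    and "n + m < K"
  shows "M n m = C * dual_sum K n m"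
  using \<open>n + m < K\<close>
proof (induction m arbitrary: n)
  case 0
  then show ?case using init dual_sum_0[OF assms(1)] by simp
next
  case (Suc m)
  have "q ^ n * M n (Suc m) = q ^ n * (C * dual_sum K n (Suc m))"
  proof -
    have "M n m = C * dual_sum K n m" "M (Suc n) m = C * dual_sum K (Suc n) m"
      using Suc by auto
    moreover have "q ^ n * dual_sum K n (Suc m) - q ^ m * dual_sum K (Suc n) m
        = (q ^ n - q ^ m) * (1 - a\<^sup>2 * q ^ (m + n)) * dual_sum K n m"
      using dual_sum_rec[OF assms(1), of n K m] Suc.prems by auto
    moreover have "N * x' = N * (C * y')"
      if "N * x' - M * x = e * x0" "N * y' - M * y = e * y0" "x0 = C * y0" "x = C * y"
      for N M x x' y y' x0 y0 e :: complex
      using that by algebra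
    ultimately show ?thesis
      using rec[of n m] by blast
  qed
  then show ?case using q by simp
qed

text \<open>Nonzero \<open>b * c\<close>, \<open>b * d\<close>, \<open>c * d\<close> let the
  quotients in \<open>W87\<close> simplify, for instance \<open>s / (b * c) = a * d\<close>. The
  infinite sum is finite because \<open>q powi (- int n)\<close> terminates it.\<close>

lemma dual_sum_eq_W87:
  assumes "b * c \<noteq> 0" "b * d \<noteq> 0" "c * d \<noteq> 0" "n < K" "m < K"
  shows "dual_sum K n m = (qpochs [a * b, a * c, a * d] q m * qpochs [a * b, a * c, a * d] q n
           / (qpoch s q m * qpoch s q n))
        * W87 (s / q) (b * c) (b * d) (c * d)
            (q powi (- int m)) (q powi (- int n)) q (a\<^sup>2 * q ^ (m + n))"
proof -
  define G where "G n = qpochs [a * b, a * c, a * d] q n" for n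
  define T where "T k = (1 - s / q * q ^ (2 * k)) / (1 - s / q)
        * (qpochs [s / q, b * c, b * d, c * d, q powi (- int m), q powi (- int n)] q k
           / qpochs [q, a * d, a * c, a * b, s * q ^ m, s * q ^ n] q k)
        * (a\<^sup>2 * q ^ (m + n)) ^ k" for k
  have par: "s / q * q / (b * c) = a * d" "s / q * q / (b * d) = a * c" "s / q * q / (c * d) = a * b"
    "s / q * q / (q powi (- int j)) = s * q ^ j" for j
    using q assms by (simp_all add: power_int_minus field_simps)
  have W: "W87 (s / q) (b * c) (b * d) (c * d)
            (q powi (- int m)) (q powi (- int n)) q (a\<^sup>2 * q ^ (m + n)) = (\<Sum>k. T k)"
    unfolding W87_def par T_def ..
  \<comment> \<open>Each factor \<open>1 - q powi (- int n) * q ^ j\<close> takes one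
    \<open>q ^ n\<close> from the argument and becomes \<open>q ^ n - q ^ j\<close>.\<close>
  have pn: "qpoch (q powi (- int n)) q k * (q ^ n) ^ k = (\<Prod>j<k. q ^ n - q ^ j)" for n k
  proof (induction k)
    case (Suc k)
    have "(1 - q powi (- int n) * q ^ k) * q ^ n = q ^ n - q ^ k"
      using q by (simp add: power_int_minus left_diff_distrib)
    then show ?case
      by (simp add: qpoch_Suc mult_ac flip: Suc.IH)
  qed simp
  have term_eq: "dual_weight k * dual_poly k n * dual_poly k m = G m * G n / (qpoch s q m * qpoch s q n) * T k" for k
  proof -
    have "T k = dual_weight k * (qpoch (q powi (- int m)) q k * (q ^ m) ^ k) * (qpoch (q powi (- int n)) q k * (q ^ n) ^ k)
         / (qpoch (s * q ^ m) q k * qpoch (s * q ^ n) q k)"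
      unfolding T_def dual_weight_def qpochs_Cons qpochs_Nil power_mult power_mult_distrib power_add
        divide_inverse inverse_mult_distrib by (simp only: mult_ac mult_1_left mult_1_right)
    then show ?thesis
      unfolding pn dual_poly_def G_def[symmetric] qpoch_add divide_inverse inverse_mult_distrib
      by (simp only: mult_ac)
  qed
  have "T k = 0" if "k \<notin> {..<K}" for k
  proof -
    have "n < k" using assms that by simp
    then have "(\<Prod>j<k. q ^ n - q ^ j) = 0"
      by (auto intro!: prod_zero)
    then have "qpoch (q powi (- int n)) q k = 0"
      using q unfolding pn[symmetric] by simp
    then show ?thesis by (simp add: T_def)
  qed
  then have "(\<Sum>k. T k) = (\<Sum>k<K. T k)"
    by (intro suminf_finite) auto
  then show ?thesis
    unfolding W dual_sum_def term_eq G_def by (simp add: sum_distrib_left)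
qed

end

subsection \<open>Infinite \<open>q\<close>-shifted factorials\<close>

lemma summable_norm_mult_power:
  fixes x q :: complex
  assumes "norm q < 1"
  shows "summable (\<lambda>j. norm (x * q ^ j))"
  using assms by (auto simp: norm_mult norm_power intro!: summable_mult summable_geometric)

lemma convergent_prod_qpoch:
  assumes "norm q < 1"
  shows "convergent_prod (\<lambda>j. 1 - x * q ^ j :: complex)"
proof -
  have "abs_convergent_prod (\<lambda>j. 1 - x * q ^ j)"
    unfolding abs_convergent_prod_conv_summable using summable_norm_mult_power[OF assms, of x] by simp
  then show ?thesis by (rule abs_convergent_prod_imp_convergent_prod)
qed

lemma qpoch_LIMSEQ:
  assumes "norm q < 1"
  shows "(\<lambda>n. qpoch x q n) \<longlonglongrightarrow> qpoch_inf x q"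
  using convergent_prod_LIMSEQ[OF convergent_prod_qpoch[OF assms, of x]]
  unfolding qpoch_def qpoch_inf_def LIMSEQ_lessThan_iff_atMost .

lemma qpoch_inf_unique:
  assumes "norm q < 1" "(\<lambda>n. qpoch x q n) \<longlonglongrightarrow> y"
  shows "qpoch_inf x q = y"
  using LIMSEQ_unique[OF qpoch_LIMSEQ[OF assms(1)] assms(2)] .

lemma qpoch_inf_nonzero:
  assumes "norm q < 1" "norm x < 1"
  shows "qpoch_inf x q \<noteq> 0"
  unfolding qpoch_inf_def
  using convergent_prod_qpoch[OF assms(1)] one_minus_mult_power_nonzero[OF assms(2)] assms(1)
  by (intro prodinf_nonzero) auto

lemma qpoch_inf_0 [simp]: "qpoch_inf 0 q = 1"
  by (simp add: qpoch_inf_def)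

lemma qpoch_inf_split:
  assumes "norm q < 1"
  shows "qpoch_inf x q = qpoch x q n * qpoch_inf (x * q ^ n) q"
proof (rule qpoch_inf_unique[OF assms])
  have "(\<lambda>k. qpoch x q n * qpoch (x * q ^ n) q k) \<longlonglongrightarrow> qpoch x q n * qpoch_inf (x * q ^ n) q"
    by (intro tendsto_intros qpoch_LIMSEQ assms)
  then have "(\<lambda>k. qpoch x q (k + n)) \<longlonglongrightarrow> qpoch x q n * qpoch_inf (x * q ^ n) q"
    by (simp add: qpoch_add add.commute[of _ n])
  then show "(\<lambda>k. qpoch x q k) \<longlonglongrightarrow> qpoch x q n * qpoch_inf (x * q ^ n) q"
    by (rule LIMSEQ_offset)
qed

lemma qpoch_inf_head:
  assumes "norm q < 1"
  shows "qpoch_inf x q = (1 - x) * qpoch_inf (x * q) q"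
  using qpoch_inf_split[OF assms, of x 1] by (simp add: qpoch_def)

lemma norm_power2_less_1: "norm (q::complex) < 1 \<Longrightarrow> norm (q\<^sup>2) < 1"
  by (simp add: norm_power power_less_one_iff abs_square_less_1)

lemma qpoch_inf_minus:
  assumes "norm q < 1"
  shows "qpoch_inf (x\<^sup>2) (q\<^sup>2) = qpoch_inf x q * qpoch_inf (- x) q"
proof (rule qpoch_inf_unique)
  have "qpoch (x\<^sup>2) (q\<^sup>2) n = qpoch x q n * qpoch (- x) q n" for n
    by (simp add: qpoch_def power2_eq_square algebra_simps power_mult_distrib flip: prod.distrib)
  then show "(\<lambda>n. qpoch (x\<^sup>2) (q\<^sup>2) n) \<longlonglongrightarrow> qpoch_inf x q * qpoch_inf (- x) q"
    by (simp add: tendsto_mult qpoch_LIMSEQ assms)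
qed (rule norm_power2_less_1[OF assms])

lemma qpoch_inf_even_odd:
  assumes "norm q < 1"
  shows "qpoch_inf x q = qpoch_inf x (q\<^sup>2) * qpoch_inf (x * q) (q\<^sup>2)"
proof -
  have "qpoch x q (2 * n) = qpoch x (q\<^sup>2) n * qpoch (x * q) (q\<^sup>2) n" for n
    by (induction n) (simp_all add: qpoch_Suc mult_ac flip: power_mult)
  moreover have "(\<lambda>n. qpoch x q (2 * n)) \<longlonglongrightarrow> qpoch_inf x q"
    using LIMSEQ_subseq_LIMSEQ[OF qpoch_LIMSEQ[OF assms], of "\<lambda>n. 2 * n"]
    by (simp add: strict_mono_def o_def)
  moreover have "(\<lambda>n. qpoch x (q\<^sup>2) n * qpoch (x * q) (q\<^sup>2) n) \<longlonglongrightarrow>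
      qpoch_inf x (q\<^sup>2) * qpoch_inf (x * q) (q\<^sup>2)"
    by (intro tendsto_mult qpoch_LIMSEQ norm_power2_less_1 assms)
  ultimately show ?thesis by (simp add: LIMSEQ_unique)
qed

text \<open>Even and odd exponents are separated, and each half is then factored as a difference of
  squares. This contracts the four numerator factors of the weight; \<open>r\<close> may be either
  square root of \<open>q\<close>.\<close>

lemma qpoch_inf_square:
  assumes "norm q < 1" "r\<^sup>2 = q"
  shows "qpoch_inf (x\<^sup>2) q = qpoch_inf x q * qpoch_inf (- x) q * qpoch_inf (x * r) q * qpoch_inf (- (x * r)) q"
  using qpoch_inf_even_odd[OF assms(1), of "x\<^sup>2"] qpoch_inf_minus[OF assms(1), of x]
    qpoch_inf_minus[OF assms(1), of "x * r"] assms(2)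
  by (simp add: power_mult_distrib)

text \<open>The factors differ from 1 by at most \<open>R * norm q ^ j\<close>, so the M-test
  applies. This supports both holomorphy and the passage to the limit under the integral.\<close>

lemma uniform_limit_qpoch:
  assumes "norm q < 1"
  shows "uniform_limit (cball 0 R) (\<lambda>n x. qpoch x q n) (\<lambda>x. qpoch_inf x q) sequentially"
proof -
  have "uniformly_convergent_on (cball 0 R) (\<lambda>n x. \<Prod>j<n. 1 - x * q ^ j)"
  proof (rule uniformly_convergent_on_prod')
    show "uniformly_convergent_on (cball 0 R) (\<lambda>n x. \<Sum>j<n. norm (1 - x * q ^ j - 1))"
    proof (rule Weierstrass_m_test')
      show "norm (norm (1 - x * q ^ j - 1)) \<le> R * norm q ^ j" if "x \<in> cball 0 R" for j x
        using that by (simp add: norm_mult norm_power mult_right_mono)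
      show "summable (\<lambda>j. R * norm q ^ j)"
        using assms by (intro summable_mult summable_geometric) simp
    qed
  qed (auto intro!: continuous_intros)
  then obtain l where l: "uniform_limit (cball 0 R) (\<lambda>n x. qpoch x q n) l sequentially"
    unfolding uniformly_convergent_on_def qpoch_def by blast
  have "l x = qpoch_inf x q" if "x \<in> cball 0 R" for x
    using LIMSEQ_unique[OF tendsto_uniform_limitI[OF l that] qpoch_LIMSEQ[OF assms]] .
  then show ?thesis using l by (subst uniform_limit_cong') auto
qed

lemma holomorphic_qpoch_inf:
  assumes "norm q < 1"
  shows "(\<lambda>x. qpoch_inf x q) holomorphic_on UNIV"
proof (rule holomorphic_uniform_sequence)
  fix x :: complex
  show "\<exists>e>0. cball x e \<subseteq> UNIV \<and> uniform_limit (cball x e) (\<lambda>n x. qpoch x q n) (\<lambda>x. qpoch_inf x q) sequentially"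
    by (intro exI[of _ 1] conjI uniform_limit_on_subset[OF uniform_limit_qpoch[OF assms, of "norm x + 1"]])
       (auto simp: dist_norm, smt (verit) norm_minus_commute norm_triangle_ineq2)
qed (auto simp: qpoch_def intro!: holomorphic_intros)

lemma holomorphic_qpoch_inf' [holomorphic_intros]:
  assumes "norm q < 1" "f holomorphic_on S"
  shows "(\<lambda>z. qpoch_inf (f z) q) holomorphic_on S"
  using holomorphic_on_compose[OF assms(2) holomorphic_on_subset[OF holomorphic_qpoch_inf[OF assms(1)]]]
  by (simp add: o_def)

lemma continuous_on_qpoch_inf [continuous_intros]:
  fixes f :: "'a::topological_space \<Rightarrow> complex"
  assumes "norm q < 1" "continuous_on S f"
  shows "continuous_on S (\<lambda>z. qpoch_inf (f z) q)"
  using continuous_on_compose2[OF holomorphic_on_imp_continuous_on[OF holomorphic_qpoch_inf[OF assms(1)]] assms(2)]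
  by simp

lemma continuous_on_qpoch [continuous_intros]:
  fixes f :: "'a::topological_space \<Rightarrow> complex"
  assumes "continuous_on S f"
  shows "continuous_on S (\<lambda>z. qpoch (f z) q n)"
  unfolding qpoch_def by (intro continuous_intros assms)

subsection \<open>Integrals over the unit circle\<close>

text \<open>The angular measure corresponds to \<open>dz / (i z)\<close> and is preserved by
  \<open>z -> 1/z\<close>.\<close>

definition circle_integral :: "(complex \<Rightarrow> complex) \<Rightarrow> complex" where
  "circle_integral f = integral {0..2*pi} (\<lambda>t. f (cis t))"

lemma continuous_on_circle:
  assumes "continuous_on (sphere 0 1) f"
  shows "continuous_on S (\<lambda>t. f (cis t))"
  by (rule continuous_on_compose2[OF assms]) (auto intro!: continuous_intros)

lemma circle_integrable:
  fixes f :: "complex \<Rightarrow> complex"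
  assumes "continuous_on (sphere 0 1) f"
  shows "(\<lambda>t. f (cis t)) integrable_on {a..b::real}"
  by (intro integrable_continuous_real continuous_on_circle assms)

lemma circle_integral_cong:
  assumes "\<And>z. norm z = 1 \<Longrightarrow> f z = g z"
  shows "circle_integral f = circle_integral g"
  unfolding circle_integral_def by (intro integral_cong assms) simp

lemma circle_integral_mult: "circle_integral (\<lambda>z. c * f z) = c * circle_integral f"
  by (simp add: circle_integral_def)

lemma circle_integral_minus: "circle_integral (\<lambda>z. - f z) = - circle_integral f"
  by (simp add: circle_integral_def)

lemma circle_integral_add:
  assumes "continuous_on (sphere 0 1) f" "continuous_on (sphere 0 1) g"
  shows "circle_integral (\<lambda>z. f z + g z) = circle_integral f + circle_integral g"
  unfolding circle_integral_def by (intro integral_add circle_integrable assms)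

lemma circle_integral_diff:
  assumes "continuous_on (sphere 0 1) f" "continuous_on (sphere 0 1) g"
  shows "circle_integral (\<lambda>z. f z - g z) = circle_integral f - circle_integral g"
  unfolding circle_integral_def by (intro integral_diff circle_integrable assms)

text \<open>Substitution \<open>t -> 2*pi - t\<close>, composed of a reflection and a shift by the
  period of \<open>cis\<close>.\<close>

lemma integral_reflect_cis:
  fixes f :: "complex \<Rightarrow> complex"
  shows "integral {a..b} (\<lambda>t. f (cis t)) = integral {2*pi-b..2*pi-a} (\<lambda>t. f (inverse (cis t)))"
proof -
  have "integral {2*pi-b..2*pi-a} (\<lambda>t. f (inverse (cis t)))
      = integral {-b+2*pi..-a+2*pi} (\<lambda>t. f (inverse (cis t)))"
    by (simp add: algebra_simps)
  also have "\<dots> = integral {-b..-a} ((\<lambda>t. f (inverse (cis t))) \<circ> (+) (2*pi))"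
    by (rule integral_shift_Icc_real[symmetric])
  also have "\<dots> = integral {-b..-a} (\<lambda>t. f (cis (- t)))"
    unfolding o_def cis_mult[symmetric] by simp
  also have "\<dots> = integral {a..b} (\<lambda>t. f (cis t))"
    using Henstock_Kurzweil_Integration.integral_reflect_real[of b a "\<lambda>t. f (cis t)"] by simp
  finally show ?thesis ..
qed

lemma circle_integral_inverse: "circle_integral (\<lambda>z. f (inverse z)) = circle_integral f"
  unfolding circle_integral_def integral_reflect_cis[of 0 "2*pi" f] by simp

lemma circle_integral_symmetric:
  assumes "continuous_on (sphere 0 1) f" "\<And>z. norm z = 1 \<Longrightarrow> f (inverse z) = f z"
  shows "circle_integral f = 2 * integral {0..pi} (\<lambda>t. f (cis t))"
proof -
  have "circle_integral f = integral {0..pi} (\<lambda>t. f (cis t)) + integral {pi..2*pi} (\<lambda>t. f (cis t))"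
    unfolding circle_integral_def
    by (intro Henstock_Kurzweil_Integration.integral_combine[symmetric] circle_integrable assms) auto
  also have "integral {pi..2*pi} (\<lambda>t. f (cis t)) = integral {0..pi} (\<lambda>t. f (inverse (cis t)))"
    by (simp add: integral_reflect_cis[of pi])
  also have "\<dots> = integral {0..pi} (\<lambda>t. f (cis t))"
    by (intro integral_cong assms) simp
  finally show ?thesis by simp
qed

text \<open>Both sides are, up to the factor \<open>i\<close>, contour integrals of
  \<open>f z / z\<close>, over the circles of radius 1 and \<open>norm q\<close>; these are
  homotopic inside \<open>S - {0}\<close>.\<close>

lemma circle_integral_scale:
  fixes q :: complex
  assumes "f holomorphic_on S" "open S" "{z. norm q \<le> norm z \<and> norm z \<le> 1} \<subseteq> S" "0 < norm q" "norm q < 1"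
  shows "circle_integral f = circle_integral (\<lambda>z. f (q * z))"
proof -
  define F where "F z = f z / z" for z
  define r \<phi> where "r = norm q" and "\<phi> = Arg q"
  have q: "q = of_real r * cis \<phi>"
    unfolding r_def \<phi>_def by (simp add: rcis_cmod_Arg flip: rcis_def)
  have r: "0 < r" "r < 1" using assms by (auto simp: r_def)
  let ?g = "part_circlepath 0 1 0 (2*pi)" and ?h = "part_circlepath 0 r \<phi> (\<phi> + 2*pi)"
  have "homotopic_loops (S - {0}) ?g ?h"
    unfolding homotopic_loops
  \<comment> \<open>The radius shrinks as \<open>r powr s\<close> from 1 to \<open>r\<close>, and
    the starting angle turns from 0 to \<open>\<phi>\<close> because \<open>q\<close> may be
    complex.\<close>
  proof (intro exI[of _ "\<lambda>(s, x). of_real (r powr s) * cis (s * \<phi> + 2 * pi * x)"] conjI ballI)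
    show "continuous_on ({0..1} \<times> {0..1}) (\<lambda>(s, x). of_real (r powr s) * cis (s * \<phi> + 2 * pi * x))"
      using r by (auto simp: case_prod_beta intro!: continuous_intros)
    have "r \<le> r powr s" "r powr s \<le> 1" if "0 \<le> s" "s \<le> 1" for s
      using r that powr_mono'[of s 1 r] powr_mono'[of 0 s r] by auto
    then show "(\<lambda>(s, x). of_real (r powr s) * cis (s * \<phi> + 2 * pi * x)) \<in> {0..1} \<times> {0..1} \<rightarrow> S - {0}"
      using r assms(3) by (auto simp: norm_mult r_def[symmetric] intro!: subsetD[OF assms(3)])
    show "pathfinish ((\<lambda>(s, x). of_real (r powr s) * cis (s * \<phi> + 2 * pi * x)) \<circ> Pair t) =
        pathstart ((\<lambda>(s, x). of_real (r powr s) * cis (s * \<phi> + 2 * pi * x)) \<circ> Pair t)" for t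
      by (simp add: pathfinish_def pathstart_def flip: cis_mult)
  qed (use r in \<open>auto simp: part_circlepath_def linepath_def cis_conv_exp algebra_simps\<close>)
  then have "contour_integral ?g F = contour_integral ?h F"
  proof (rule Cauchy_theorem_homotopic_loops)
    show "F holomorphic_on S - {0}"
      unfolding F_def by (intro holomorphic_intros holomorphic_on_subset[OF assms(1)]) auto
  qed (use assms(2) in auto)
  moreover have "contour_integral ?g F = \<i> * circle_integral f"
    unfolding contour_integral_part_circlepath_eq[of 0 "2*pi", simplified]
    by (simp add: F_def circle_integral_def mult.commute flip: integral_mult_right)
  moreover have "contour_integral ?h F = \<i> * circle_integral (\<lambda>z. f (q * z))"
  proof -
    have "contour_integral ?h F = integral {\<phi>..\<phi>+2*pi} (\<lambda>t. \<i> * f (r * cis t))"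
      unfolding contour_integral_part_circlepath_eq[of \<phi> "\<phi>+2*pi", simplified]
      using r by (simp add: F_def mult_ac)
    also have "\<dots> = integral {0..2*pi} ((\<lambda>t. \<i> * f (r * cis t)) \<circ> (+) \<phi>)"
      using integral_shift_Icc_real[of 0 "2*pi" "\<lambda>t. \<i> * f (r * cis t)" \<phi>] by (simp add: add.commute)
    also have "\<dots> = \<i> * circle_integral (\<lambda>z. f (q * z))"
      by (simp add: circle_integral_def q o_def mult_ac flip: cis_mult)
    finally show ?thesis .
  qed
  ultimately show ?thesis by simp
qed

lemma circle_integral_LIMSEQ:
  assumes "uniform_limit (sphere 0 1) f g sequentially" "\<And>n. continuous_on (sphere 0 1) (f n)"
  shows "(\<lambda>n. circle_integral (f n)) \<longlonglongrightarrow> circle_integral g"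
proof -
  have "uniform_limit {0..2*pi} (\<lambda>n t. f n (cis t)) (\<lambda>t. g (cis t)) sequentially"
    by (rule uniform_limit_compose'[OF assms(1)]) auto
  then obtain I J where "\<And>n. ((\<lambda>t. f n (cis t)) has_integral I n) {0..2*pi}"
    "((\<lambda>t. g (cis t)) has_integral J) {0..2*pi}" "I \<longlonglongrightarrow> J"
    by (rule uniform_limit_integral) (auto intro: continuous_on_circle assms)
  moreover from this have "circle_integral (f n) = I n" "circle_integral g = J" for n
    unfolding circle_integral_def by (simp_all add: integral_unique)
  ultimately show ?thesis by simp
qed

subsection \<open>The Askey-Wilson integral\<close>

text \<open>The numerator is the product of the four \<open>aw_h\<close> factors of
  \<open>aw_weight\<close>, contracted by \<open>qpoch_inf_square\<close>.\<close>

definition aw_circle_weight ::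
    "complex \<Rightarrow> complex \<Rightarrow> complex \<Rightarrow> complex \<Rightarrow> complex \<Rightarrow> complex \<Rightarrow> complex" where
  "aw_circle_weight q a b c d z = qpoch_inf (z\<^sup>2) q * qpoch_inf ((inverse z)\<^sup>2) q
     / (qpoch_inf (a * z) q * qpoch_inf (a * inverse z) q * qpoch_inf (b * z) q * qpoch_inf (b * inverse z) q
      * qpoch_inf (c * z) q * qpoch_inf (c * inverse z) q * qpoch_inf (d * z) q * qpoch_inf (d * inverse z) q)"

definition aw_circle_integral ::
    "complex \<Rightarrow> complex \<Rightarrow> complex \<Rightarrow> complex \<Rightarrow> complex \<Rightarrow> complex" where
  "aw_circle_integral q a b c d = circle_integral (aw_circle_weight q a b c d)"

definition aw_basis :: "complex \<Rightarrow> complex \<Rightarrow> nat \<Rightarrow> complex \<Rightarrow> complex" where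
  "aw_basis q a n z = qpoch (a * z) q n * qpoch (a * inverse z) q n"

lemma qpoch_inf_nonzero_circle:
  assumes "norm q < 1" "norm a < 1" "norm z = 1"
  shows "qpoch_inf (a * z) q \<noteq> 0" "qpoch_inf (a * inverse z) q \<noteq> 0"
  using assms by (intro qpoch_inf_nonzero; simp add: norm_mult norm_inverse)+

lemma continuous_on_aw_circle_weight:
  assumes "norm q < 1" "norm a < 1" "norm b < 1" "norm c < 1" "norm d < 1"
  shows "continuous_on (sphere 0 1) (aw_circle_weight q a b c d)"
  unfolding aw_circle_weight_def [abs_def]
  using assms by (intro continuous_intros) (auto simp: qpoch_inf_nonzero_circle)

lemma continuous_on_aw_basis: "continuous_on (sphere 0 1) (aw_basis q a n)"
  unfolding aw_basis_def [abs_def] by (intro continuous_intros) auto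

lemma aw_circle_weight_inverse: "aw_circle_weight q a b c d (inverse z) = aw_circle_weight q a b c d z"
  by (simp add: aw_circle_weight_def mult_ac)

lemma aw_basis_inverse: "aw_basis q a n (inverse z) = aw_basis q a n z"
  by (simp add: aw_basis_def mult_ac)

lemma aw_basis_0 [simp]: "aw_basis q a 0 z = 1"
  by (simp add: aw_basis_def)

lemma aw_basis_Suc:
  "aw_basis q a (Suc n) z = aw_basis q a n z * ((1 - a * z * q ^ n) * (1 - a * inverse z * q ^ n))"
  by (simp add: aw_basis_def qpoch_Suc mult_ac)

text \<open>Splitting \<open>n\<close> factors off the two denominator products for \<open>a\<close>
  lets the basis function be absorbed into the parameter.\<close>

lemma aw_circle_weight_shift:
  assumes "norm q < 1" "norm a < 1" "norm z = 1"
  shows "aw_circle_weight q (a * q ^ n) b c d z = aw_circle_weight q a b c d z * aw_basis q a n z"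
proof -
  have "qpoch_inf (a * z) q = qpoch (a * z) q n * qpoch_inf (a * q ^ n * z) q"
    "qpoch_inf (a * inverse z) q = qpoch (a * inverse z) q n * qpoch_inf (a * q ^ n * inverse z) q"
    using qpoch_inf_split[OF assms(1), of "a * z" n] qpoch_inf_split[OF assms(1), of "a * inverse z" n]
    by (simp_all add: mult_ac)
  then show ?thesis
    using qpoch_inf_nonzero_circle[OF assms] unfolding aw_circle_weight_def aw_basis_def by simp
qed

text \<open>The limit of \<open>aw_circle_weight_shift\<close> as \<open>n\<close> grows, written
  over the same fixed weight so that only \<open>qpoch\<close> varies.\<close>

lemma aw_circle_weight_0:
  assumes "norm q < 1" "norm a < 1" "norm z = 1"
  shows "aw_circle_weight q 0 b c d z
    = aw_circle_weight q a b c d z * (qpoch_inf (a * z) q * qpoch_inf (a * inverse z) q)"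
  using qpoch_inf_nonzero_circle[OF assms] unfolding aw_circle_weight_def by simp

text \<open>Adjacent transpositions suffice to bring any parameter to the front.\<close>

lemma aw_circle_integral_commute:
  "aw_circle_integral q a b c d = aw_circle_integral q b a c d"
  "aw_circle_integral q a b c d = aw_circle_integral q a c b d"
  "aw_circle_integral q a b c d = aw_circle_integral q a b d c"
  unfolding aw_circle_integral_def aw_circle_weight_def [abs_def] by (simp_all add: mult_ac)

text \<open>Expand in the elementary symmetric functions of the parameters. With
  \<open>z * y = 1\<close> the contribution of the second one cancels, and the rest is linear in
  \<open>z + y\<close>.\<close>

lemma symmetrized_kernel_identity:
  fixes z y a b c d :: complex
  assumes "z * y = 1"
  shows "z * (1 - z\<^sup>2) * ((1 - a * y) * (1 - b * y) * (1 - c * y) * (1 - d * y))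
      + y * (1 - y\<^sup>2) * ((1 - a * z) * (1 - b * z) * (1 - c * z) * (1 - d * z))
    = (1 - z\<^sup>2) * (1 - y\<^sup>2) * ((1 - a * b * c * d) * (z + y) - (a + b + c + d - (a*b*c + a*b*d + a*c*d + b*c*d)))"
proof -
  have expand: "(1 - a * x) * (1 - b * x) * (1 - c * x) * (1 - d * x) =
      1 - (a + b + c + d) * x + (a*b + a*c + a*d + b*c + b*d + c*d) * x\<^sup>2
      - (a*b*c + a*b*d + a*c*d + b*c*d) * x^3 + (a * b * c * d) * x^4" for x
    by algebra
  have "z * (1 - z\<^sup>2) * (1 - e1 * y + e2 * y\<^sup>2 - e3 * y^3 + e4 * y^4)
      + y * (1 - y\<^sup>2) * (1 - e1 * z + e2 * z\<^sup>2 - e3 * z^3 + e4 * z^4)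
    = (1 - z\<^sup>2) * (1 - y\<^sup>2) * ((1 - e4) * (z + y) - (e1 - e3))" for e1 e2 e3 e4
    using assms by algebra
  then show ?thesis
    unfolding expand .
qed

lemma aw_circle_integral_first_moment:
  assumes q: "q \<noteq> 0" "norm q < 1" and "norm a < 1" "norm b < 1" "norm c < 1" "norm d < 1"
  shows "circle_integral (\<lambda>z. aw_circle_weight q a b c d z *
    ((1 - a * b * c * d) * (z + inverse z) - (a + b + c + d - (a*b*c + a*b*d + a*c*d + b*c*d)))) = 0"
proof -
  define g where "g z = z * qpoch_inf (z\<^sup>2) q * qpoch_inf (q * (inverse z)\<^sup>2) q
     / (qpoch_inf (a * z) q * qpoch_inf (a * q * inverse z) q * qpoch_inf (b * z) q * qpoch_inf (b * q * inverse z) q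
      * qpoch_inf (c * z) q * qpoch_inf (c * q * inverse z) q * qpoch_inf (d * z) q * qpoch_inf (d * q * inverse z) q)" for z
  \<comment> \<open>An open neighbourhood of the closed annulus on which no denominator factor of
    \<open>g\<close> vanishes.\<close>
  define S where "S = {z::complex. z \<noteq> 0} \<inter> (\<Inter>x\<in>{a, b, c, d}. {z. norm (x * z) < 1} \<inter> {z. norm (x * q) < norm z})"
  have "open S"
    unfolding S_def by (intro open_Int open_INT ballI open_Collect_less open_Collect_neq continuous_intros) auto
  have annulus: "{z. norm q \<le> norm z \<and> norm z \<le> 1} \<subseteq> S"
  proof
    fix z :: complex assume "z \<in> {z. norm q \<le> norm z \<and> norm z \<le> 1}"
    then have z: "norm q \<le> norm z" "norm z \<le> 1" by auto
    have *: "norm (x * z) < 1 \<and> norm (x * q) < norm z" if "norm x < 1" for x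
    proof -
      have "norm (x * z) \<le> norm x * 1"
        unfolding norm_mult using z by (intro mult_left_mono) auto
      moreover have "norm (x * q) < 1 * norm q"
        unfolding norm_mult using that q by (intro mult_strict_right_mono) auto
      ultimately show ?thesis using that z by linarith
    qed
    have "z \<noteq> 0" using z q by auto
    with *[OF assms(3)] *[OF assms(4)] *[OF assms(5)] *[OF assms(6)] show "z \<in> S"
      by (simp add: S_def)
  qed
  have nz: "qpoch_inf (x * z) q \<noteq> 0" "qpoch_inf (x * q * inverse z) q \<noteq> 0" if "z \<in> S" "x \<in> {a, b, c, d}" for x z
  proof -
    have "norm (x * z) < 1" "norm (x * q) < norm z" "z \<noteq> 0"
      using that by (auto simp: S_def)
    then have "norm (x * z) < 1" "norm (x * q * inverse z) < 1"
      by (simp_all add: norm_mult norm_inverse norm_divide field_simps)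
    then show "qpoch_inf (x * z) q \<noteq> 0" "qpoch_inf (x * q * inverse z) q \<noteq> 0"
      by (intro qpoch_inf_nonzero q(2); simp)+
  qed
  have hol: "g holomorphic_on S"
  proof -
    have S0: "z \<noteq> 0" if "z \<in> S" for z
      using that by (simp add: S_def)
    have den: "qpoch_inf (a * z) q * qpoch_inf (a * q * inverse z) q * qpoch_inf (b * z) q * qpoch_inf (b * q * inverse z) q
      * qpoch_inf (c * z) q * qpoch_inf (c * q * inverse z) q * qpoch_inf (d * z) q * qpoch_inf (d * q * inverse z) q \<noteq> 0"
      if "z \<in> S" for z
      using nz[OF that, of a] nz[OF that, of b] nz[OF that, of c] nz[OF that, of d] by simp
    show ?thesis
      unfolding g_def [abs_def] by (intro holomorphic_intros q(2) S0 den)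
  qed
  have circle: "sphere 0 1 \<subseteq> S"
    using annulus q by auto
  have cont: "continuous_on (sphere 0 1) g"
    using holomorphic_on_imp_continuous_on[OF holomorphic_on_subset[OF hol circle]] .
  have cont': "continuous_on (sphere 0 1) (\<lambda>z. g (inverse z))"
    by (intro continuous_on_compose2[OF cont] continuous_intros) (auto simp: norm_inverse)
  \<comment> \<open>The denominator products merely trade places; one head factor of each numerator
    product changes, and these produce the sign.\<close>
  have anti: "g (q * z) = - g (inverse z)" if "norm z = 1" for z
  proof -
    have z: "z \<noteq> 0" using that by auto
    define y where "y = inverse z"
    have zy: "z * y = 1" using z by (simp add: y_def)
    have iy: "inverse y = z" by (simp add: y_def)
    have "inverse q * y\<^sup>2 * q = y\<^sup>2"
      using q by simp
    then have 1: "qpoch_inf (inverse q * y\<^sup>2) q = (1 - inverse q * y\<^sup>2) * qpoch_inf (y\<^sup>2) q"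
      using qpoch_inf_head[OF q(2), of "inverse q * y\<^sup>2"] by (simp only:)
    have "q * z\<^sup>2 * q = q\<^sup>2 * z\<^sup>2"
      by (simp add: power2_eq_square)
    then have 2: "qpoch_inf (q * z\<^sup>2) q = (1 - q * z\<^sup>2) * qpoch_inf (q\<^sup>2 * z\<^sup>2) q"
      using qpoch_inf_head[OF q(2), of "q * z\<^sup>2"] by (simp only:)
    have "q * z * (1 - p * y\<^sup>2) = - y * (1 - q * z\<^sup>2)" if "q * p = 1" for p
      using zy that by algebra
    from this[of "inverse q"] have 3: "q * z * (1 - inverse q * y\<^sup>2) = - y * (1 - q * z\<^sup>2)"
      using q by simp
    have "w * (A * B) = - (y * (B' * A'))"
      if "B = u * B'" "A' = v * A" "w * u = - y * v" for w A B A' B' u v :: complex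
      using that by algebra
    from this[OF 1 2 3] have num: "q * z * (qpoch_inf (q\<^sup>2 * z\<^sup>2) q * qpoch_inf (inverse q * y\<^sup>2) q)
        = - (y * (qpoch_inf (y\<^sup>2) q * qpoch_inf (q * z\<^sup>2) q))" .
    have e1: "(q * z)\<^sup>2 = q\<^sup>2 * z\<^sup>2" "q * (inverse (q * z))\<^sup>2 = inverse q * y\<^sup>2"
      using q z by (simp_all add: y_def power2_eq_square field_simps)
    have e2: "x * q * inverse (q * z) = x * y" "x * (q * z) = x * q * z" for x
      using q z by (simp_all add: y_def)
    have "g (q * z) = (q * z * (qpoch_inf (q\<^sup>2 * z\<^sup>2) q * qpoch_inf (inverse q * y\<^sup>2) q))
        / (qpoch_inf (a * y) q * qpoch_inf (a * q * z) q * qpoch_inf (b * y) q * qpoch_inf (b * q * z) q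
      * qpoch_inf (c * y) q * qpoch_inf (c * q * z) q * qpoch_inf (d * y) q * qpoch_inf (d * q * z) q)"
      unfolding g_def e1 e2 by (simp only: mult_ac)
    also have "\<dots> = - g (inverse z)"
      unfolding num y_def[symmetric] g_def iy by (simp only: mult_ac minus_divide_left[symmetric])
    finally show ?thesis .
  qed
  have "circle_integral g = circle_integral (\<lambda>z. g (q * z))"
    using hol \<open>open S\<close> annulus q by (intro circle_integral_scale) auto
  also have "\<dots> = - circle_integral (\<lambda>z. g (inverse z))"
    unfolding circle_integral_minus[symmetric] by (intro circle_integral_cong anti)
  finally have "circle_integral g + circle_integral (\<lambda>z. g (inverse z)) = 0"
    by simp
  then have "circle_integral (\<lambda>z. g z + g (inverse z)) = 0"
    by (simp add: circle_integral_add cont cont')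
  also have "circle_integral (\<lambda>z. g z + g (inverse z)) = circle_integral (\<lambda>z. aw_circle_weight q a b c d z *
    ((1 - a * b * c * d) * (z + inverse z) - (a + b + c + d - (a*b*c + a*b*d + a*c*d + b*c*d))))"
  \<comment> \<open>Taking the head factor out of each product leaves the common factor
    \<open>H / D\<close>, to which the symmetrized identity applies.\<close>
  proof (rule circle_integral_cong)
    fix z :: complex assume z1: "norm z = 1"
    then have z: "z \<noteq> 0" by auto
    define y where "y = inverse z"
    have zy: "z * y = 1" using z by (simp add: y_def)
    have iy: "inverse y = z" by (simp add: y_def)
    define H where "H = qpoch_inf (q * z\<^sup>2) q * qpoch_inf (q * y\<^sup>2) q"
    define D where "D = qpoch_inf (a * z) q * qpoch_inf (a * y) q * qpoch_inf (b * z) q * qpoch_inf (b * y) q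
      * qpoch_inf (c * z) q * qpoch_inf (c * y) q * qpoch_inf (d * z) q * qpoch_inf (d * y) q"
    have nzc: "qpoch_inf (x * z) q \<noteq> 0" "qpoch_inf (x * y) q \<noteq> 0" if "x \<in> {a, b, c, d}" for x
      using qpoch_inf_nonzero_circle[OF q(2) _ z1, of x] that assms unfolding y_def by auto
    have head: "qpoch_inf x q = (1 - x) * qpoch_inf (q * x) q" for x
      using qpoch_inf_head[OF q(2), of x] by (simp add: mult_ac)
    have sh: "inverse (qpoch_inf (x * q * y) q) = (1 - x * y) * inverse (qpoch_inf (x * y) q)"
         "inverse (qpoch_inf (x * q * z) q) = (1 - x * z) * inverse (qpoch_inf (x * z) q)" if "x \<in> {a, b, c, d}" for x
    proof -
      have cancel: "inverse P' = (1 - u) * inverse P" if "P = (1 - u) * P'" "P \<noteq> 0" for P P' u :: complex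
        using that by simp
      have "q * (x * y) = x * q * y" "q * (x * z) = x * q * z"
        by (simp_all only: mult_ac)
      then show "inverse (qpoch_inf (x * q * y) q) = (1 - x * y) * inverse (qpoch_inf (x * y) q)"
         "inverse (qpoch_inf (x * q * z) q) = (1 - x * z) * inverse (qpoch_inf (x * z) q)"
        using cancel[OF head[of "x * y"]] cancel[OF head[of "x * z"]] nzc[OF that] by (simp_all only: not_False_eq_True)
    qed
    have in_set: "a \<in> {a, b, c, d}" "b \<in> {a, b, c, d}" "c \<in> {a, b, c, d}" "d \<in> {a, b, c, d}"
      by simp_all
    have w: "aw_circle_weight q a b c d z = (1 - z\<^sup>2) * (1 - y\<^sup>2) * (H * inverse D)"
      unfolding aw_circle_weight_def y_def[symmetric] head[of "z\<^sup>2"] head[of "y\<^sup>2"]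
      by (simp only: H_def D_def divide_inverse mult_ac)
    have g1: "g z = (z * (1 - z\<^sup>2) * ((1 - a * y) * (1 - b * y) * (1 - c * y) * (1 - d * y))) * (H * inverse D)"
      unfolding g_def y_def[symmetric] head[of "z\<^sup>2"] divide_inverse inverse_mult_distrib D_def H_def
        in_set[THEN sh(1)]
      by (simp only: mult_ac)
    have g2: "g y = (y * (1 - y\<^sup>2) * ((1 - a * z) * (1 - b * z) * (1 - c * z) * (1 - d * z))) * (H * inverse D)"
      unfolding g_def iy head[of "y\<^sup>2"] divide_inverse inverse_mult_distrib D_def H_def
        in_set[THEN sh(2)]
      by (simp only: mult_ac)
    show "g z + g (inverse z) = aw_circle_weight q a b c d z *
      ((1 - a * b * c * d) * (z + inverse z) - (a + b + c + d - (a*b*c + a*b*d + a*c*d + b*c*d)))"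
      unfolding y_def[symmetric] w g1 g2 distrib_right[symmetric] symmetrized_kernel_identity[OF zy]
      by (simp only: mult_ac)
  qed
  finally show ?thesis .
qed

text \<open>Replacing \<open>a\<close> by \<open>a * q\<close> multiplies the weight by
  \<open>(1 - a * z) * (1 - a / z)\<close>, which is linear in \<open>z + 1/z\<close>. Up to a
  multiple of the vanishing moment it can be traded for a constant.\<close>

lemma aw_circle_integral_step:
  assumes q: "q \<noteq> 0" "norm q < 1" and ab: "norm a < 1" "norm b < 1" "norm c < 1" "norm d < 1"
  shows "(1 - a * b * c * d) * aw_circle_integral q (a * q) b c d
    = (1 - a * b) * (1 - a * c) * (1 - a * d) * aw_circle_integral q a b c d"
proof -
  let ?W = "aw_circle_weight q a b c d"
  let ?L = "\<lambda>z. ?W z * ((1 - a * b * c * d) * (z + inverse z) - (a + b + c + d - (a*b*c + a*b*d + a*c*d + b*c*d)))"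
  have contW: "continuous_on (sphere 0 1) ?W"
    using q ab by (intro continuous_on_aw_circle_weight)
  have contL: "continuous_on (sphere 0 1) ?L"
    by (intro continuous_intros contW) auto
  have "(1 - a * b * c * d) * aw_circle_integral q (a * q) b c d
      = circle_integral (\<lambda>z. (1 - a * b * c * d) * aw_circle_weight q (a * q) b c d z)"
    by (simp add: circle_integral_mult aw_circle_integral_def)
  also have "\<dots> = circle_integral (\<lambda>z. (1 - a * b) * (1 - a * c) * (1 - a * d) * ?W z - a * ?L z)"
  proof (rule circle_integral_cong)
    fix z :: complex assume z1: "norm z = 1"
    then have "z \<noteq> 0" by auto
    then have z: "z * inverse z = 1" by simp
    have "aw_circle_weight q (a * q) b c d z = ?W z * ((1 - a * z) * (1 - a * inverse z))"
      using aw_circle_weight_shift[OF q(2) ab(1) z1, of 1 b c d] by (simp add: aw_basis_def qpoch_def)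
    then show "(1 - a * b * c * d) * aw_circle_weight q (a * q) b c d z
       = (1 - a * b) * (1 - a * c) * (1 - a * d) * ?W z - a * ?L z"
      using z by algebra
  qed
  also have "\<dots> = circle_integral (\<lambda>z. (1 - a * b) * (1 - a * c) * (1 - a * d) * ?W z) - circle_integral (\<lambda>z. a * ?L z)"
    by (intro circle_integral_diff continuous_on_mult continuous_on_const contW contL)
  also have "\<dots> = (1 - a * b) * (1 - a * c) * (1 - a * d) * aw_circle_integral q a b c d - a * 0"
    unfolding circle_integral_mult aw_circle_integral_first_moment[OF q ab] aw_circle_integral_def ..
  finally show ?thesis by simp
qed

lemma aw_circle_integral_shift:
  assumes q: "q \<noteq> 0" "norm q < 1" and ab: "norm a < 1" "norm b < 1" "norm c < 1" "norm d < 1"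
  shows "qpoch (a * b * c * d) q n * aw_circle_integral q (a * q ^ n) b c d
    = qpochs [a * b, a * c, a * d] q n * aw_circle_integral q a b c d"
proof (induction n)
  case (Suc n)
  have step: "(1 - a * b * c * d * q ^ n) * aw_circle_integral q (a * q ^ Suc n) b c d
    = (1 - a * b * q ^ n) * (1 - a * c * q ^ n) * (1 - a * d * q ^ n) * aw_circle_integral q (a * q ^ n) b c d"
    using aw_circle_integral_step[OF q norm_mult_power_less_1[OF ab(1), of q n] ab(2-4)] q(2)
    by (simp add: mult_ac)
  show ?case
  proof -
    have "S * u * I' = A * u\<^sub>1 * (B * u\<^sub>2 * (C * u\<^sub>3 * 1)) * I"
      if "u * I' = u\<^sub>1 * u\<^sub>2 * u\<^sub>3 * I\<^sub>n" "S * I\<^sub>n = A * (B * (C * 1)) * I"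
      for S u I' A u\<^sub>1 B u\<^sub>2 C u\<^sub>3 I I\<^sub>n :: complex
      using that by algebra
    from this[OF step Suc.IH[unfolded qpochs_Cons qpochs_Nil]] show ?thesis
      unfolding qpoch_Suc qpochs_Cons qpochs_Nil .
  qed
qed simp

text \<open>The shift formula is taken to the limit, where \<open>a * q ^ n\<close> tends to 0.
  Uniform convergence on the circle allows the limit to enter the integral.\<close>

lemma aw_circle_integral_reduce:
  assumes q: "q \<noteq> 0" "norm q < 1" and ab: "norm a < 1" "norm b < 1" "norm c < 1" "norm d < 1"
  shows "qpoch_inf (a * b * c * d) q * aw_circle_integral q 0 b c d
    = qpochs_inf [a * b, a * c, a * d] q * aw_circle_integral q a b c d"
proof -
  have contW: "continuous_on (sphere 0 1) (aw_circle_weight q a b c d)"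
    using q ab by (intro continuous_on_aw_circle_weight)
  have lim: "(\<lambda>n. aw_circle_integral q (a * q ^ n) b c d) \<longlonglongrightarrow> aw_circle_integral q 0 b c d"
    unfolding aw_circle_integral_def
  proof (rule circle_integral_LIMSEQ)
    have ul: "uniform_limit (sphere 0 1) (\<lambda>n z. qpoch (a * f z) q n) (\<lambda>z. qpoch_inf (a * f z) q) sequentially"
      if "\<And>z. norm z = 1 \<Longrightarrow> norm (f z) = 1" for f :: "complex \<Rightarrow> complex"
      using ab(1) that by (intro uniform_limit_compose'[OF uniform_limit_qpoch[OF q(2), of 1]]) (auto simp: norm_mult)
    have bdd: "bounded (f ` sphere 0 1)" if "continuous_on (sphere 0 1) f" for f :: "complex \<Rightarrow> complex"
      by (intro compact_imp_bounded compact_continuous_image that) simp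
    have "uniform_limit (sphere 0 1)
        (\<lambda>n z. aw_circle_weight q a b c d z * (qpoch (a * z) q n * qpoch (a * inverse z) q n))
        (\<lambda>z. aw_circle_weight q a b c d z * (qpoch_inf (a * z) q * qpoch_inf (a * inverse z) q)) sequentially"
    proof (rule uniform_lim_mult[OF uniform_limit_const uniform_lim_mult[OF ul ul]])
      have c: "continuous_on (sphere 0 1) (\<lambda>z. qpoch_inf (a * z) q)"
        by (intro continuous_intros q(2))
      have c': "continuous_on (sphere 0 1) (\<lambda>z. qpoch_inf (a * inverse z) q)"
        by (intro continuous_intros q(2)) auto
      show "bounded ((\<lambda>z. qpoch_inf (a * z) q) ` sphere 0 1)"
        "bounded ((\<lambda>z. qpoch_inf (a * inverse z) q) ` sphere 0 1)"
        "bounded ((\<lambda>z. qpoch_inf (a * z) q * qpoch_inf (a * inverse z) q) ` sphere 0 1)"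
        by (rule bdd[OF c] bdd[OF c'] bdd[OF continuous_on_mult[OF c c']])+
      show "bounded (aw_circle_weight q a b c d ` sphere 0 1)"
        by (intro bdd contW)
    qed (simp_all add: norm_inverse)
    then show "uniform_limit (sphere 0 1) (\<lambda>n. aw_circle_weight q (a * q ^ n) b c d)
        (aw_circle_weight q 0 b c d) sequentially"
      by (subst uniform_limit_cong') (auto simp: aw_circle_weight_shift aw_circle_weight_0[of q a] q ab aw_basis_def)
    show "continuous_on (sphere 0 1) (aw_circle_weight q (a * q ^ n) b c d)" for n
      using q ab by (intro continuous_on_aw_circle_weight norm_mult_power_less_1) auto
  qed
  have "(\<lambda>n. qpoch (a * b * c * d) q n * aw_circle_integral q (a * q ^ n) b c d)
      \<longlonglongrightarrow> qpoch_inf (a * b * c * d) q * aw_circle_integral q 0 b c d"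
    by (intro tendsto_mult lim qpoch_LIMSEQ q)
  moreover have "(\<lambda>n. qpochs [a * b, a * c, a * d] q n * aw_circle_integral q a b c d)
      \<longlonglongrightarrow> qpochs_inf [a * b, a * c, a * d] q * aw_circle_integral q a b c d"
    unfolding qpochs_def qpochs_inf_def by (auto intro!: tendsto_intros qpoch_LIMSEQ q)
  ultimately show ?thesis
    by (intro LIMSEQ_unique) (simp_all only: aw_circle_integral_shift[OF q ab])
qed

text \<open>The parameters are sent to 0 one after another. Once \<open>a = 0\<close>, the product
  of all four is 0 and its \<open>qpoch_inf\<close> is 1, so each later stage contributes only
  pairwise products.\<close>

lemma aw_circle_integral_eq_base:
  assumes q: "q \<noteq> 0" "norm q < 1" and ab: "norm a < 1" "norm b < 1" "norm c < 1" "norm d < 1"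
  shows "qpochs_inf [a * b, a * c, a * d, b * c, b * d, c * d] q * aw_circle_integral q a b c d
    = qpoch_inf (a * b * c * d) q * aw_circle_integral q 0 0 0 0"
proof -
  have z: "norm (0 :: complex) < 1" by simp
  note comm = aw_circle_integral_commute[of q]
  have 1: "qpoch_inf (a * b * c * d) q * aw_circle_integral q 0 b c d
      = qpoch_inf (a * b) q * qpoch_inf (a * c) q * qpoch_inf (a * d) q * aw_circle_integral q a b c d"
    using aw_circle_integral_reduce[OF q ab] by (simp add: qpochs_inf_def mult.assoc)
  have 2: "aw_circle_integral q 0 0 c d
      = qpoch_inf (b * c) q * qpoch_inf (b * d) q * aw_circle_integral q 0 b c d"
    using aw_circle_integral_reduce[OF q ab(2) z ab(3,4)] comm(1)[of b 0 c d]
    by (simp add: qpochs_inf_def mult.assoc)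
  have 3: "aw_circle_integral q 0 0 0 d = qpoch_inf (c * d) q * aw_circle_integral q 0 0 c d"
    using aw_circle_integral_reduce[OF q ab(3) z z ab(4)] comm(1)[of c 0 0 d] comm(2)[of 0 c 0 d]
    by (simp add: qpochs_inf_def mult.assoc)
  have 4: "aw_circle_integral q 0 0 0 0 = aw_circle_integral q 0 0 0 d"
    using aw_circle_integral_reduce[OF q ab(4) z z z] comm(1)[of d 0 0 0] comm(2)[of 0 d 0 0] comm(3)[of 0 0 d 0]
    by (simp add: qpochs_inf_def mult.assoc)
  show ?thesis
    unfolding 4 3 2 using 1 by (simp add: qpochs_inf_def mult_ac)
qed

section \<open>The remaining constant, from a special choice of parameters\<close>

lemma circle_integral_const: "circle_integral (\<lambda>z. c) = 2 * of_real pi * c"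
  by (simp add: circle_integral_def scaleR_conv_of_real)

lemma aw_circle_integral_special:
  assumes q: "q \<noteq> 0" "norm q < 1" and r: "r\<^sup>2 = q"
  shows "aw_circle_integral q q (- q) r (- r) = 4 * of_real pi"
proof -
  have r1: "norm r < 1"
    using q r by (metis norm_power norm_ge_zero abs_norm_cancel abs_square_less_1)
  have "aw_circle_integral q q (- q) r (- r) = circle_integral (\<lambda>z. 2 - (z\<^sup>2 + (inverse z)\<^sup>2))"
    unfolding aw_circle_integral_def
  proof (rule circle_integral_cong)
    fix z :: complex assume z1: "norm z = 1"
    then have zz: "z * inverse z = 1" by (metis norm_zero right_inverse zero_neq_one)
    \<comment> \<open>With the heads \<open>1 - x\<close> and \<open>1 + x\<close> removed, the four
      factors are those of the denominator, so the whole denominator cancels.\<close>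
    have split: "qpoch_inf (x\<^sup>2) q = (1 - x\<^sup>2) *
        (qpoch_inf (q * x) q * qpoch_inf (- q * x) q * qpoch_inf (r * x) q * qpoch_inf (- r * x) q)" for x
      using qpoch_inf_square[OF q(2) r, of x] qpoch_inf_head[OF q(2), of x] qpoch_inf_head[OF q(2), of "- x"]
      by (simp add: power2_eq_square algebra_simps)
    have nz: "qpoch_inf (x * z) q \<noteq> 0" "qpoch_inf (x * inverse z) q \<noteq> 0" if "norm x < 1" for x
      using qpoch_inf_nonzero_circle[OF q(2) that z1] .
    have "aw_circle_weight q q (- q) r (- r) z = (1 - z\<^sup>2) * (1 - (inverse z)\<^sup>2)"
      unfolding aw_circle_weight_def split
      using nz[of q] nz[of "- q"] nz[of r] nz[of "- r"] q(2) r1 by simp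
    also have "\<dots> = 2 - (z\<^sup>2 + (inverse z)\<^sup>2)"
    proof -
      have "(1 - z\<^sup>2) * (1 - y\<^sup>2) = 2 - (z\<^sup>2 + y\<^sup>2)" if "z * y = 1" for y
        using that by algebra
      from this[OF zz] show ?thesis .
    qed
    finally show "aw_circle_weight q q (- q) r (- r) z = 2 - (z\<^sup>2 + (inverse z)\<^sup>2)" .
  qed
  also have "\<dots> = circle_integral (\<lambda>z. 2) - (circle_integral (\<lambda>z. z\<^sup>2) + circle_integral (\<lambda>z. (inverse z)\<^sup>2))"
  proof -
    have c1: "continuous_on (sphere 0 1) (\<lambda>z::complex. z\<^sup>2)"
      by (intro continuous_intros)
    have c2: "continuous_on (sphere 0 1) (\<lambda>z::complex. (inverse z)\<^sup>2)"
      by (intro continuous_intros) auto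
    show ?thesis
      by (simp only: circle_integral_diff[OF continuous_on_const continuous_on_add[OF c1 c2]]
          circle_integral_add[OF c1 c2])
  qed
  also have "circle_integral (\<lambda>z. (inverse z)\<^sup>2) = circle_integral (\<lambda>z. z\<^sup>2)"
    by (rule circle_integral_inverse)
  also have "circle_integral (\<lambda>z. z\<^sup>2) = 0"
  proof - \<comment> \<open>scaling by \<open>q\<close> multiplies this integral by \<open>q\<^sup>2 \<noteq> 1\<close>\<close>
    have "circle_integral (\<lambda>z. z\<^sup>2) = circle_integral (\<lambda>z. (q * z)\<^sup>2)"
      using q by (intro circle_integral_scale[where S = UNIV] holomorphic_intros) auto
    also have "\<dots> = q\<^sup>2 * circle_integral (\<lambda>z. z\<^sup>2)"
      by (simp add: power_mult_distrib circle_integral_mult)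
    finally have "(1 - q\<^sup>2) * circle_integral (\<lambda>z. z\<^sup>2) = 0"
      by (simp add: algebra_simps)
    moreover have "1 - q\<^sup>2 \<noteq> 0"
      using norm_power2_less_1[OF q(2)] by auto
    ultimately show ?thesis by simp
  qed
  finally show ?thesis by (simp add: circle_integral_const)
qed

text \<open>The reduction formula at \<open>q, -q, r, -r\<close> expresses the base integral by
  explicit products, which collapse by Euler's identity \<open>E * m = 1\<close>.\<close>

lemma aw_circle_integral_0:
  assumes q: "q \<noteq> 0" "norm q < 1"
  shows "qpoch_inf q q * aw_circle_integral q 0 0 0 0 = 4 * of_real pi"
proof -
  define r where "r = csqrt q"
  have r: "r\<^sup>2 = q" by (simp add: r_def)
  have r1: "norm r < 1"
    using q r by (metis norm_power norm_ge_zero abs_norm_cancel abs_square_less_1)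
  define I where "I = aw_circle_integral q 0 0 0 0"
  define Q where "Q = qpoch_inf q q"
  define Q3 where "Q3 = qpoch_inf (q^3) q"
  define m where "m = qpoch_inf (- q) q"
  define m2 where "m2 = qpoch_inf (- (q\<^sup>2)) q"
  define E where "E = qpoch_inf q (q\<^sup>2)"
  define e where "e = qpoch_inf (q^3) (q\<^sup>2)"
  have Q: "Q = (1 - q) * ((1 - q\<^sup>2) * Q3)"
    using qpoch_inf_head[OF q(2), of q] qpoch_inf_head[OF q(2), of "q\<^sup>2"]
    by (simp add: Q_def Q3_def power2_eq_square power3_eq_cube mult_ac)
  have m: "m = (1 + q) * m2"
    using qpoch_inf_head[OF q(2), of "- q"] by (simp add: m_def m2_def power2_eq_square)
  have E: "E = (1 - q) * e"
    using qpoch_inf_head[OF norm_power2_less_1[OF q(2)], of q]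
    by (simp add: E_def e_def power2_eq_square power3_eq_cube mult_ac)
  \<comment> \<open>The parity split gives \<open>(q;q) = (q;q^2) (q^2;q^2)\<close> for the infinite
    products, and \<open>(q^2;q^2) = (q;q) (-q;q)\<close>; cancel \<open>(q;q)\<close>.\<close>
  have Em: "E * m = 1"
  proof -
    have "Q = E * (Q * m)"
      using qpoch_inf_even_odd[OF q(2), of q] qpoch_inf_minus[OF q(2), of q]
      by (simp add: Q_def E_def m_def power2_eq_square)
    moreover have "Q \<noteq> 0"
      unfolding Q_def using q(2) by (intro qpoch_inf_nonzero)
    ultimately show ?thesis by simp
  qed
  have base: "m2 * m * e\<^sup>2 * (4 * of_real pi) = Q3 * I"
  proof -
    have e: "qpoch_inf (q * r) q * qpoch_inf (- (q * r)) q = e"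
    proof -
      have "(q * r)\<^sup>2 = q^3"
        unfolding power_mult_distrib r by (simp add: power2_eq_square power3_eq_cube)
      then show ?thesis
        using qpoch_inf_minus[OF q(2), of "q * r"] by (simp only: e_def)
    qed
    have prods: "q * - q = - (q\<^sup>2)" "q * - r = - (q * r)" "- q * r = - (q * r)" "- q * - r = q * r"
        "r * - r = - q" "- (q\<^sup>2) * r * - r = q^3"
      by (simp_all add: power2_eq_square power3_eq_cube flip: r)
    have "norm (- q) < 1" "norm (- r) < 1"
      using q r1 by simp_all
    from aw_circle_integral_eq_base[OF q q(2) this(1) r1 this(2)]
    have "m2 * (qpoch_inf (q * r) q * (qpoch_inf (- (q * r)) q * (qpoch_inf (- (q * r)) q * (qpoch_inf (q * r) q * m))))
        * (4 * of_real pi) = Q3 * I"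
      unfolding aw_circle_integral_special[OF q r] prods qpochs_inf_def
      by (simp add: m_def m2_def Q3_def I_def)
    moreover have "M * (x * (y * (y * (x * N)))) = M * N * w\<^sup>2" if "x * y = w" for x y w M N :: complex
      unfolding that[symmetric] by (simp only: power2_eq_square mult_ac)
    from this[OF e] have "m2 * (qpoch_inf (q * r) q * (qpoch_inf (- (q * r)) q * (qpoch_inf (- (q * r)) q * (qpoch_inf (q * r) q * m))))
        = m2 * m * e\<^sup>2" .
    ultimately show ?thesis by (simp only:)
  qed
  have "Q * I = (1 - q) * (1 - q\<^sup>2) * (Q3 * I)"
    unfolding Q by (simp only: mult_ac)
  also have "\<dots> = (1 - q) * (1 - q\<^sup>2) * m2 * m * e\<^sup>2 * (4 * of_real pi)"
    unfolding base[symmetric] by (simp only: mult_ac)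
  \<comment> \<open>Writing \<open>1 - q^2\<close> as \<open>(1 - q) * (1 + q)\<close> supplies the
    heads missing from \<open>e\<close>, \<open>e\<close> and \<open>m2\<close>.\<close>
  also have "(1 - q) * (1 - q\<^sup>2) * m2 * m * e\<^sup>2 = (E * m) * (E * m)"
    unfolding E m by algebra
  finally have "Q * I = (E * m) * (E * m) * (4 * of_real pi)" .
  then show ?thesis
    by (simp add: Em Q_def I_def)
qed

text \<open>The factor is \<open>4 * pi\<close> and not \<open>2 * pi\<close> because the full
  circle covers the interval from -1 to 1 twice.\<close>

lemma aw_circle_integral_eq_const:
  assumes q: "q \<noteq> 0" "norm q < 1" and ab: "norm a < 1" "norm b < 1" "norm c < 1" "norm d < 1"
  shows "aw_circle_integral q a b c d = 4 * of_real pi * aw_const q a b c d"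
proof -
  have nz: "qpoch_inf q q \<noteq> 0" "qpoch_inf (a*b) q \<noteq> 0" "qpoch_inf (a*c) q \<noteq> 0" "qpoch_inf (a*d) q \<noteq> 0"
    "qpoch_inf (b*c) q \<noteq> 0" "qpoch_inf (b*d) q \<noteq> 0" "qpoch_inf (c*d) q \<noteq> 0"
    using q ab by (simp_all add: qpoch_inf_nonzero norm_mult_less_1)
  have "qpochs_inf [q, a * b, a * c, a * d, b * c, b * d, c * d] q * aw_circle_integral q a b c d
     = qpoch_inf q q * (qpochs_inf [a * b, a * c, a * d, b * c, b * d, c * d] q * aw_circle_integral q a b c d)"
    by (simp add: qpochs_inf_def mult.assoc)
  also have "\<dots> = qpoch_inf (a * b * c * d) q * (4 * of_real pi)"
    unfolding aw_circle_integral_eq_base[OF q ab] using aw_circle_integral_0[OF q] by (simp add: mult_ac)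
  finally show ?thesis
    using nz unfolding aw_const_def by (simp add: qpochs_inf_def field_simps)
qed

subsection \<open>The substitution \<open>x = cos \<theta>\<close>\<close>

lemma has_vector_derivative_arccos_compose:
  assumes "(G has_vector_derivative g) (at (arccos x))" "-1 < x" "x < 1"
  shows "((\<lambda>x. - G (arccos x)) has_vector_derivative (g / of_real (sqrt (1 - x\<^sup>2)) :: complex)) (at x)"
proof -
  have "(arccos has_vector_derivative inverse (- sqrt (1 - x\<^sup>2))) (at x)"
    using DERIV_arccos[OF assms(2,3)] by (simp add: has_real_derivative_iff_has_vector_derivative)
  from vector_diff_chain_at[OF this assms(1)]
  have "((\<lambda>x. G (arccos x)) has_vector_derivative inverse (- sqrt (1 - x\<^sup>2)) *\<^sub>R g) (at x)"
    by (simp add: o_def)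
  from has_vector_derivative_minus[OF this] show ?thesis
    by (simp add: scaleR_conv_of_real divide_inverse mult.commute)
qed

lemma einterval_real: "einterval (ereal a) (ereal b) = {a<..<b}"
  by (auto simp: einterval_def)

text \<open>Integrability follows by domination, since \<open>f\<close> is bounded on the circle.
  The value comes from the fundamental theorem with improper endpoints.\<close>

lemma circle_substitution:
  fixes f :: "complex \<Rightarrow> complex"
  assumes f: "continuous_on (sphere 0 1) f"
  defines "h \<equiv> \<lambda>x. f (cis (arccos x)) / of_real (sqrt (1 - x\<^sup>2))"
  shows "set_integrable lborel {-1..1} h"
    and "(LBINT x:{-1..1}. h x) = integral {0..pi} (\<lambda>t. f (cis t))"
proof -
  have cf: "continuous_on S (\<lambda>t. f (cis t))" for S
    by (rule continuous_on_circle[OF f])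
  have sqrt_pos: "sqrt (1 - x\<^sup>2) > 0" if "-1 < x" "x < 1" for x :: real
    using that by (simp add: abs_square_less_1 abs_less_iff)
  have isCont_h: "isCont h x" if "-1 < x" "x < 1" for x
  proof -
    have "isCont (\<lambda>t. f (cis t)) (arccos x)"
      using cf[of UNIV] by (simp add: continuous_on_eq_continuous_at)
    from isCont_o2[OF isCont_arccos[OF that] this] show ?thesis
      unfolding h_def using sqrt_pos[OF that] by (intro continuous_intros) auto
  qed
  \<comment> \<open>The integrand is the nonnegative derivative of \<open>arcsin\<close>, which has
    finite limits at both endpoints.\<close>
  have "set_integrable lborel (einterval (ereal (-1)) (ereal 1)) (\<lambda>x::real. inverse (sqrt (1 - x\<^sup>2)))"
  proof (rule interval_integral_FTC_nonneg(1))
    show "((arcsin \<circ> real_of_ereal) \<longlongrightarrow> arcsin (-1)) (at_right (ereal (-1)))"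
      unfolding ereal_tendsto_simps
      using continuous_on_Icc_at_rightD[OF continuous_on_arcsin'] by simp
    show "((arcsin \<circ> real_of_ereal) \<longlongrightarrow> arcsin 1) (at_left (ereal 1))"
      unfolding ereal_tendsto_simps
      using continuous_on_Icc_at_leftD[OF continuous_on_arcsin'] by simp
    show "AE x in lborel. ereal (-1) < ereal x \<longrightarrow> ereal x < ereal 1 \<longrightarrow> 0 \<le> inverse (sqrt (1 - x\<^sup>2))"
      using sqrt_pos by (auto simp: less_imp_le)
    show "isCont (\<lambda>x. inverse (sqrt (1 - x\<^sup>2))) x" if "ereal (-1) < ereal x" "ereal x < ereal 1" for x
      using that sqrt_pos[of x] by (intro continuous_intros) auto
    show "(arcsin has_real_derivative inverse (sqrt (1 - x\<^sup>2))) (at x)" if "ereal (-1) < ereal x" "ereal x < ereal 1" for x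
      by (rule DERIV_arcsin) (use that in simp_all)
  qed simp
  then have int1: "set_integrable lborel {-1<..<1} (\<lambda>x::real. inverse (sqrt (1 - x\<^sup>2)))"
    by (simp only: einterval_real)
  have "compact (f ` sphere 0 1)"
    by (intro compact_continuous_image f) simp
  then obtain B where B: "\<And>z. norm z = 1 \<Longrightarrow> norm (f z) \<le> B"
    using compact_imp_bounded bounded_iff by (metis (no_types, lifting) image_eqI mem_sphere_0)
  have "set_integrable lborel {-1<..<1} (\<lambda>x::real. B * inverse (sqrt (1 - x\<^sup>2)))"
    by (intro set_integrable_mult_right int1)
  then have int_open: "set_integrable lborel {-1<..<1} h"
  proof (rule set_integrable_bound)
    show "set_borel_measurable lborel {-1<..<1} h"
      unfolding set_borel_measurable_def
      using isCont_h by (auto intro!: borel_measurable_continuous_on_indicator continuous_at_imp_continuous_on)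
    have "norm (h x) \<le> norm (B * inverse (sqrt (1 - x\<^sup>2)))" if "x \<in> {-1<..<1}" for x
    proof -
      have "norm (h x) = norm (f (cis (arccos x))) * inverse (sqrt (1 - x\<^sup>2))"
        using sqrt_pos[of x] that by (simp add: h_def norm_divide divide_inverse norm_mult norm_inverse)
      also have "\<dots> \<le> B * inverse (sqrt (1 - x\<^sup>2))"
        using sqrt_pos[of x] that by (intro mult_right_mono B) auto
      finally show ?thesis by simp
    qed
    then show "AE x in lborel. x \<in> {-1<..<1} \<longrightarrow> norm (h x) \<le> norm (B * inverse (sqrt (1 - x\<^sup>2)))"
      by auto
  qed
  \<comment> \<open>at \<open>x = -1\<close> and \<open>x = 1\<close> the denominator of \<open>h\<close> is \<open>0\<close>, so \<open>h\<close> takes the value \<open>0\<close>\<close>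
  have "(\<lambda>x. indicator {-1..1} x *\<^sub>R h x) = (\<lambda>x. indicator {-1<..<1} x *\<^sub>R h x)"
    by (auto simp: fun_eq_iff h_def indicator_def)
  then show "set_integrable lborel {-1..1} h"
    using int_open by (simp add: set_integrable_def)
  \<comment> \<open>The antiderivative of \<open>h\<close> is \<open>- G (arccos x)\<close>; the
    sign makes up for \<open>arccos\<close> being decreasing.\<close>
  define G where "G t = integral {0..t} (\<lambda>t. f (cis t))" for t
  have G: "(G has_vector_derivative f (cis t)) (at t)" if "0 < t" "t < pi" for t
  proof -
    have "(G has_vector_derivative f (cis t)) (at t within {0..pi})"
      unfolding G_def using that by (intro integral_has_vector_derivative cf) auto
    then show ?thesis using that by (simp add: at_within_Icc_at)
  qed
  have contG: "continuous_on {-1..1} (\<lambda>x. - G (arccos x))"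
  proof (rule continuous_on_minus, rule continuous_on_compose2[of "{0..pi}" G "{-1..1}" arccos])
    show "continuous_on {0..pi} G"
      unfolding G_def by (intro indefinite_integral_continuous_1 integrable_continuous_real cf)
    show "arccos ` {-1..1} \<subseteq> {0..pi}"
      using arccos_lbound arccos_ubound by auto
  qed (rule continuous_on_arccos')
  have "(LBINT x=ereal (-1)..ereal 1. h x) = (- G (arccos 1)) - (- G (arccos (-1)))"
  proof (rule interval_integral_FTC_integrable)
    show "((\<lambda>x. - G (arccos x)) has_vector_derivative h x) (at x)" if "ereal (-1) < ereal x" "ereal x < ereal 1" for x
      unfolding h_def using that arccos_lt_bounded[of x]
      by (intro has_vector_derivative_arccos_compose G) auto
    show "(((\<lambda>x. - G (arccos x)) \<circ> real_of_ereal) \<longlongrightarrow> - G (arccos (-1))) (at_right (ereal (-1)))"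
      unfolding ereal_tendsto_simps using continuous_on_Icc_at_rightD[OF contG] by simp
    show "(((\<lambda>x. - G (arccos x)) \<circ> real_of_ereal) \<longlongrightarrow> - G (arccos 1)) (at_left (ereal 1))"
      unfolding ereal_tendsto_simps using continuous_on_Icc_at_leftD[OF contG] by simp
    show "set_integrable lborel (einterval (ereal (-1)) (ereal 1)) h"
      unfolding einterval_real by (rule int_open)
    show "isCont h x" if "ereal (-1) < ereal x" "ereal x < ereal 1" for x
      by (rule isCont_h) (use that in simp_all)
  qed simp
  also have "\<dots> = integral {0..pi} (\<lambda>t. f (cis t))"
    by (simp add: G_def)
  finally show "(LBINT x:{-1..1}. h x) = integral {0..pi} (\<lambda>t. f (cis t))"
    by (simp add: interval_integral_Icc)
qed

lemma aw_integrand_eq: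
  fixes q a b c d :: complex and n m :: nat
  assumes "norm q < 1"
  defines "F \<equiv> \<lambda>z. aw_circle_weight q a b c d z * aw_basis q a n z * aw_basis q a m z"
  shows "aw_integrand q a b c d n m = (\<lambda>x. F (cis (arccos x)) / of_real (sqrt (1 - x\<^sup>2)))"
proof
  fix x
  define z where "z = cis (arccos x)"
  have z': "cis (- arccos x) = inverse z" by (simp add: z_def)
  have h: "aw_h q x y = qpoch_inf (y * z) q * qpoch_inf (y * inverse z) q" for y
    by (simp add: aw_h_def qpochs_inf_def z' flip: z_def)
  have sq: "qpoch_inf (x\<^sup>2) q = qpoch_inf (1 * x) q * qpoch_inf (- 1 * x) q * qpoch_inf (csqrt q * x) q * qpoch_inf (- csqrt q * x) q" for x
    using qpoch_inf_square[OF assms(1), of "csqrt q" x] by (simp add: mult.commute)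
  have "aw_weight q a b c d x = aw_circle_weight q a b c d z"
    unfolding aw_weight_def h aw_circle_weight_def sq by (simp only: mult_ac)
  then show "aw_integrand q a b c d n m x = F (cis (arccos x)) / of_real (sqrt (1 - x\<^sup>2))"
    unfolding aw_integrand_def F_def z_def[symmetric] z' by (simp add: aw_basis_def)
qed

subsection \<open>Moments of the weight\<close>

context askey_wilson begin

definition moment :: "nat \<Rightarrow> nat \<Rightarrow> complex" where
  "moment n m = circle_integral (\<lambda>z. aw_circle_weight q a b c d z * aw_basis q a n z * aw_basis q a m z)"

lemma continuous_on_moment:
  "continuous_on (sphere 0 1) (\<lambda>z. aw_circle_weight q a b c d z * aw_basis q a n z * aw_basis q a m z)"
  by (intro continuous_on_mult continuous_on_aw_circle_weight continuous_on_aw_basis q norm_less_1)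

lemma moment_0:
  "moment n 0 = 4 * of_real pi * aw_const q a b c d * (qpochs [a * b, a * c, a * d] q n / qpoch s q n)"
proof -
  have "moment n 0 = aw_circle_integral q (a * q ^ n) b c d"
    unfolding moment_def aw_circle_integral_def
    by (rule circle_integral_cong) (simp add: aw_circle_weight_shift q norm_less_1)
  moreover have "qpoch s q n \<noteq> 0"
    using norm_products q by (intro qpoch_nonzero) auto
  moreover note aw_circle_integral_shift[OF q norm_less_1, of n] aw_circle_integral_eq_const[OF q norm_less_1]
  ultimately show ?thesis by (simp add: field_simps)
qed

text \<open>The identity already holds for the integrands: in the combination the coefficients of
  \<open>z + 1/z\<close> cancel.\<close>

lemma moment_rec:
  "q ^ n * moment n (Suc m) - q ^ m * moment (Suc n) m
    = (q ^ n - q ^ m) * (1 - a\<^sup>2 * q ^ (m + n)) * moment n m"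
proof -
  let ?F = "\<lambda>n m z. aw_circle_weight q a b c d z * aw_basis q a n z * aw_basis q a m z"
  have "q ^ n * moment n (Suc m) - q ^ m * moment (Suc n) m
      = circle_integral (\<lambda>z. q ^ n * ?F n (Suc m) z - q ^ m * ?F (Suc n) m z)"
    unfolding moment_def circle_integral_mult[symmetric]
    by (intro circle_integral_diff[symmetric] continuous_on_mult[OF continuous_on_const] continuous_on_moment)
  also have "\<dots> = circle_integral (\<lambda>z. (q ^ n - q ^ m) * (1 - a\<^sup>2 * q ^ (m + n)) * ?F n m z)"
  proof (rule circle_integral_cong)
    fix z :: complex assume "norm z = 1"
    then have z: "z * inverse z = 1" by (metis norm_zero right_inverse zero_neq_one)
    have "N * (w * f * (g * ((1 - a * z * M) * (1 - a * y * M)))) - M * (w * (f * ((1 - a * z * N) * (1 - a * y * N))) * g)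
        = (N - M) * (1 - a\<^sup>2 * (M * N)) * (w * f * g)" if "z * y = 1" for N M w f g y
      using that by algebra
    from this[OF z] show "q ^ n * ?F n (Suc m) z - q ^ m * ?F (Suc n) m z
        = (q ^ n - q ^ m) * (1 - a\<^sup>2 * q ^ (m + n)) * ?F n m z"
      unfolding aw_basis_Suc power_add .
  qed
  finally show ?thesis
    unfolding moment_def circle_integral_mult .
qed

lemma moment_eq_dual_sum:
  assumes "1 - s / q \<noteq> 0" "n + m < K"
  shows "moment n m = 4 * of_real pi * aw_const q a b c d * dual_sum K n m"
  using assms by (intro dual_sum_unique moment_rec moment_0)

lemma moment_eq_half:
  "moment n m = 2 * integral {0..pi}
    (\<lambda>t. aw_circle_weight q a b c d (cis t) * aw_basis q a n (cis t) * aw_basis q a m (cis t))"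
  unfolding moment_def
  by (rule circle_integral_symmetric[OF continuous_on_moment])
     (simp only: aw_circle_weight_inverse aw_basis_inverse)

end

section \<open>Assembly of the integral evaluation\<close>

theorem theorem3p9:
  fixes q a b c d :: complex and n m :: nat
  assumes "0 < norm q" and "norm q < 1"
    and "Max {norm a, norm b, norm c, norm d} < 1"
    and "b * c \<noteq> 0" and "b * d \<noteq> 0" and "c * d \<noteq> 0"
    and "1 - a * b * c * d / q \<noteq> 0"
  shows "set_integrable lborel {-1..1} (aw_integrand q a b c d n m)
    \<and> 1 / (2 * of_real pi) * (LBINT x:{-1..1}. aw_integrand q a b c d n m x)
      = aw_const q a b c d
        * (qpochs [a * b, a * c, a * d] q m * qpochs [a * b, a * c, a * d] q n
           / (qpoch (a * b * c * d) q m * qpoch (a * b * c * d) q n))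
        * W87 (a * b * c * d / q) (b * c) (b * d) (c * d)
            (q powi (- int m)) (q powi (- int n)) q (a\<^sup>2 * q ^ (m + n))"
proof -
  interpret askey_wilson q a b c d
    using assms by unfold_locales auto
  note int = circle_substitution[OF continuous_on_moment[of n m], folded aw_integrand_eq[OF q(2), of a b c d n m]]
  \<comment> \<open>The half-circle integral is half of \<open>moment n m\<close>, which turns
    \<open>2 * pi\<close> into \<open>4 * pi\<close>.\<close>
  have "1 / (2 * of_real pi) * (LBINT x:{-1..1}. aw_integrand q a b c d n m x)
      = moment n m / (4 * of_real pi)"
    unfolding int(2) moment_eq_half by simp
  \<comment> \<open>\<open>Suc (n + m)\<close> is the least cutoff above \<open>n + m\<close>, and
    it also exceeds \<open>n\<close> and \<open>m\<close>.\<close>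
  also have "\<dots> = aw_const q a b c d * dual_sum (Suc (n + m)) n m"
    using moment_eq_dual_sum[OF assms(7), of n m "Suc (n + m)"] by simp
  finally show ?thesis
    using int(1) dual_sum_eq_W87[OF assms(4-6), of n "Suc (n + m)" m] by (simp add: mult.assoc)
qed

end
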